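(* Let $(S,R)$ be a Randers space, $R=\sqrt{h}+\omega$, let $\beta>0$ be a function on $S$, and consider the Randers space $(\mathbb{R}_u\times S,R_\beta)$ with $R_\beta(v,y)=\sqrt{h(y,y)+\frac{v^2}{\beta(x)}}+\omega(y)$ for $(v,y)\in T_{(u,x)}(\mathbb{R}_u\times S)$. Let $D$ be a domain of class $C^{2}$ of $S$, and let $\phi$ be a $C^2$ function with $\phi=0$ exactly on $\partial D$, $\phi>0$ on $D$ and $\mathrm{d}\phi\neq0$ on $\partial D$. Then $(\mathbb{R}_u\times\partial D;R_\beta)$ is infinitesimally convex if and only if the following three conditions hold for all $x\in\partial D$: i) $(\partial D;R)$ is infinitesimally convex, i.e. $H^h_\phi(y,y)+\sqrt{h(y,y)}\,\big|\mathrm{d}\omega(y,\nabla^h\phi)\big|\le0$ for $y\in T_x\partial D$; ii) $\nabla^h\beta$ does not point outside $D$ at $x$, i.e. $0\le h_x(\nabla^h\phi,\nabla^h\beta)$; iii) for each $y\in T_x\partial D$, either $$\mathrm{d}\omega(y,\nabla^h\phi)^2+\frac{h(\nabla^h\phi,\nabla^h\beta)}{\beta}\,H^h_\phi(y,y)\le0,$$ or $h(\nabla^h\phi,\nabla^h\beta)>0$ and $$2H^h_\phi(y,y)+\frac{\beta}{h(\nabla^h\phi,\nabla^h\beta)}\,\mathrm{d}\omega(y,\nabla^h\phi)^2+\frac{h(\nabla^h\phi,\nabla^h\beta)}{\beta}\,h(y,y)\le0.$$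
   Context: A Randers space $(S,R)$ is a manifold $S$ with a Riemannian metric $h$ and a one-form $\omega$ with $\|\omega\|_x=\sup_{y\in T_xS\setminus\{0\}}|\omega(y)|/\sqrt{h(y,y)}<1$ for all $x$, endowed with the Finsler metric $R(y)=\sqrt{h(y,y)}+\omega(y)$. $\mathbb{R}_u$ is a copy of $\mathbb{R}$ with coordinate $u$. $\nabla^h$ and $H^h_\phi$ denote the gradient and Hessian with respect to $h$. A domain is an open connected subset; class $C^2$ means its closure is a manifold with boundary and $\partial D$ is $C^2$. For a Finsler metric $F$ and a domain with $C^2$ boundary defined by $\phi$ (zero exactly on the boundary, positive inside, nonzero differential on the boundary), the boundary is infinitesimally convex if $(H_\phi)_y(y,y)\le0$ for all nonzero $y$ tangent to the boundary, where $H_\phi$ is the Hessian for the Chern connection, so $(H_\phi)_y(y,y)=(\phi\circ\gamma)''(0)$ for the constant-speed $F$-geodesic $\gamma$ with $\dot\gamma(0)=y$. For $\mathbb{R}_u\times\partial D=\partial(\mathbb{R}_u\times D)$ the defining function is $\phi_1(u,x)=\phi(x)$. *)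

theory Defs
  imports "HOL-Analysis.Analysis"
begin

section \<open>Calculus in a Euclidean space\<close>

abbreviation dir_deriv :: "('n::euclidean_space \<Rightarrow> 'm::real_normed_vector) \<Rightarrow> 'n \<Rightarrow> 'n \<Rightarrow> 'm" where
  "dir_deriv f p a \<equiv> frechet_derivative f (at p) a"

primrec C_on :: "nat \<Rightarrow> ('n::euclidean_space \<Rightarrow> 'm::real_normed_vector) \<Rightarrow> 'n set \<Rightarrow> bool" where
  "C_on 0 f U \<longleftrightarrow> continuous_on U f"
| "C_on (Suc k) f U \<longleftrightarrow>
     (\<forall>p\<in>U. f differentiable (at p)) \<and> (\<forall>a. C_on k (\<lambda>p. dir_deriv f p a) U)"

definition Cinf_on :: "('n::euclidean_space \<Rightarrow> 'm::real_normed_vector) \<Rightarrow> 'n set \<Rightarrow> bool" where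
  "Cinf_on f U \<longleftrightarrow> (\<forall>k. C_on k f U)"

text \<open>The vector that represents the linear form \<open>f\<close> with respect to the scalar product \<open>g\<close>.\<close>

definition riesz :: "('n \<Rightarrow> 'n \<Rightarrow> real) \<Rightarrow> ('n \<Rightarrow> real) \<Rightarrow> 'n" where
  "riesz g f = (THE z. \<forall>w. g z w = f w)"

text \<open>Christoffel symbols of the second kind of the metric field \<open>g\<close> on an open subset of a
  Euclidean space, contracted with \<open>a\<close> and \<open>b\<close>, that is, the vector with components
  \<open>g\<^sup>k\<^sup>l (\<partial>\<^sub>i g\<^sub>j\<^sub>l + \<partial>\<^sub>j g\<^sub>i\<^sub>l - \<partial>\<^sub>l g\<^sub>i\<^sub>j) a\<^sup>i b\<^sup>j / 2\<close>.\<close>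

definition christoffel ::
    "('n::euclidean_space \<Rightarrow> 'n \<Rightarrow> 'n \<Rightarrow> real) \<Rightarrow> 'n \<Rightarrow> 'n \<Rightarrow> 'n \<Rightarrow> 'n" where
  "christoffel g p a b = riesz (g p)
     (\<lambda>w. (dir_deriv (\<lambda>p. g p b w) p a + dir_deriv (\<lambda>p. g p a w) p b
           - dir_deriv (\<lambda>p. g p a b) p w) / 2)"

text \<open>Second derivative of \<open>f\<close> corrected by connection coefficients \<open>\<Gamma>\<close>:
  \<open>a (b f) - (\<nabla>\<^sub>a b) f\<close> for constant \<open>a\<close>, \<open>b\<close>.\<close>

definition hessian_coord ::
    "('n::euclidean_space \<Rightarrow> 'n \<Rightarrow> 'n) \<Rightarrow> ('n \<Rightarrow> real) \<Rightarrow> 'n \<Rightarrow> 'n \<Rightarrow> 'n \<Rightarrow> real" where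
  "hessian_coord \<Gamma> f p a b =
     dir_deriv (\<lambda>p. dir_deriv f p b) p a - dir_deriv f p (\<Gamma> a b)"


section \<open>Manifolds\<close>

text \<open>A manifold is given by an indexed atlas on a type \<open>'a\<close>. The maps are total
  functions; only their values on the chart domains matter.\<close>

record ('i, 'a, 'n) atlas =
  chart_index :: "'i set"
  chart_dom :: "'i \<Rightarrow> 'a set"
  chart_map :: "'i \<Rightarrow> 'a \<Rightarrow> 'n"

definition open_embedding_on ::
    "'a::topological_space set \<Rightarrow> ('a \<Rightarrow> 'n::topological_space) \<Rightarrow> bool" where
  "open_embedding_on U \<kappa> \<longleftrightarrow> open U \<and> open (\<kappa> ` U) \<and>
     homeomorphism U (\<kappa> ` U) \<kappa> (the_inv_into U \<kappa>)"

definition transition :: "'a set \<Rightarrow> ('a \<Rightarrow> 'n) \<Rightarrow> ('a \<Rightarrow> 'm) \<Rightarrow> 'n \<Rightarrow> 'm" where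
  "transition U \<kappa> \<mu> = \<mu> \<circ> the_inv_into U \<kappa>"

definition smooth_manifold ::
    "('i, 'a::{t2_space,second_countable_topology}, 'n::euclidean_space) atlas \<Rightarrow> bool" where
  "smooth_manifold A \<longleftrightarrow>
     (\<Union>i\<in>chart_index A. chart_dom A i) = UNIV \<and>
     (\<forall>i\<in>chart_index A. open_embedding_on (chart_dom A i) (chart_map A i)) \<and>
     (\<forall>i\<in>chart_index A. \<forall>j\<in>chart_index A.
        Cinf_on (transition (chart_dom A i) (chart_map A i) (chart_map A j))
          (chart_map A i ` (chart_dom A i \<inter> chart_dom A j)))"

definition chart_inv :: "('i, 'a, 'n) atlas \<Rightarrow> 'i \<Rightarrow> 'n \<Rightarrow> 'a" where
  "chart_inv A i = the_inv_into (chart_dom A i) (chart_map A i)"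

definition charts_at :: "('i, 'a, 'n) atlas \<Rightarrow> 'a \<Rightarrow> 'i set" where
  "charts_at A x = {i \<in> chart_index A. x \<in> chart_dom A i}"

text \<open>An arbitrary chart around \<open>x\<close>. It serves to evaluate expressions in coordinates;
  each expression it is used for below has the same value in every chart around \<open>x\<close>.\<close>

definition chart_at :: "('i, 'a, 'n) atlas \<Rightarrow> 'a \<Rightarrow> 'i" where
  "chart_at A x = (SOME i. i \<in> charts_at A x)"

definition C_manifold ::
    "nat \<Rightarrow> ('i, 'a, 'n::euclidean_space) atlas \<Rightarrow> ('a \<Rightarrow> real) \<Rightarrow> bool" where
  "C_manifold k A f \<longleftrightarrow>
     (\<forall>i\<in>chart_index A. C_on k (f \<circ> chart_inv A i) (chart_map A i ` chart_dom A i))"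

definition Cinf_manifold ::
    "('i, 'a, 'n::euclidean_space) atlas \<Rightarrow> ('a \<Rightarrow> real) \<Rightarrow> bool" where
  "Cinf_manifold A f \<longleftrightarrow> (\<forall>k. C_manifold k A f)"

text \<open>A tangent vector at \<open>x\<close> is the family of its components in the charts around \<open>x\<close>,
  which transform by the derivatives of the transition maps. Components in the other charts
  are set to 0, so that tangent vectors are equal iff their components are.\<close>

definition tangent_space ::
    "('i, 'a, 'n::euclidean_space) atlas \<Rightarrow> 'a \<Rightarrow> ('i \<Rightarrow> 'n) set" where
  "tangent_space A x = {y.
     (\<forall>i. i \<notin> charts_at A x \<longrightarrow> y i = 0) \<and>
     (\<forall>i\<in>charts_at A x. \<forall>j\<in>charts_at A x.
        y j = dir_deriv (chart_map A j \<circ> chart_inv A i) (chart_map A i x) (y i))}"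

text \<open>The tangent vector at \<open>x\<close> with components \<open>a\<close> in the chart \<open>i\<close>.\<close>

definition tvec ::
    "('i, 'a, 'n::euclidean_space) atlas \<Rightarrow> 'i \<Rightarrow> 'a \<Rightarrow> 'n \<Rightarrow> 'i \<Rightarrow> 'n" where
  "tvec A i x a = (\<lambda>j. if j \<in> charts_at A x
     then dir_deriv (chart_map A j \<circ> chart_inv A i) (chart_map A i x) a else 0)"

text \<open>Local representatives, in the chart \<open>i\<close>, of functions of one or two tangent vectors.\<close>

definition loc1 :: "('i, 'a, 'n::euclidean_space) atlas \<Rightarrow> ('a \<Rightarrow> ('i \<Rightarrow> 'n) \<Rightarrow> real) \<Rightarrow>
    'i \<Rightarrow> 'n \<Rightarrow> 'n \<Rightarrow> real" where
  "loc1 A F i p a = F (chart_inv A i p) (tvec A i (chart_inv A i p) a)"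

definition loc2 :: "('i, 'a, 'n::euclidean_space) atlas \<Rightarrow>
    ('a \<Rightarrow> ('i \<Rightarrow> 'n) \<Rightarrow> ('i \<Rightarrow> 'n) \<Rightarrow> real) \<Rightarrow> 'i \<Rightarrow> 'n \<Rightarrow> 'n \<Rightarrow> 'n \<Rightarrow> real" where
  "loc2 A h i p a b =
     h (chart_inv A i p) (tvec A i (chart_inv A i p) a) (tvec A i (chart_inv A i p) b)"

text \<open>The vectors tangent at \<open>x\<close> to a submanifold \<open>N\<close>: velocities at time 0 of curves
  in \<open>N\<close> through \<open>x\<close>.\<close>

definition tangent_to ::
    "('i, 'a::topological_space, 'n::euclidean_space) atlas \<Rightarrow> 'a set \<Rightarrow> 'a \<Rightarrow> ('i \<Rightarrow> 'n) set" where
  "tangent_to A N x = {y \<in> tangent_space A x.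
     \<exists>\<gamma>::real \<Rightarrow> 'a. \<gamma> 0 = x \<and> isCont \<gamma> 0 \<and> range \<gamma> \<subseteq> N \<and>
       (\<forall>i\<in>charts_at A x. ((chart_map A i \<circ> \<gamma>) has_vector_derivative y i) (at 0))}"

definition differential ::
    "('i, 'a, 'n::euclidean_space) atlas \<Rightarrow> ('a \<Rightarrow> real) \<Rightarrow> 'a \<Rightarrow> ('i \<Rightarrow> 'n) \<Rightarrow> real" where
  "differential A f x y = (let i = chart_at A x in
     dir_deriv (f \<circ> chart_inv A i) (chart_map A i x) (y i))"

text \<open>Exterior derivative of a one-form, with the normalization
  \<open>d\<omega>(X,Y) = X(\<omega>(Y)) - Y(\<omega>(X)) - \<omega>([X,Y])\<close> (no factor 1/2).\<close>

definition ext_deriv :: "('i, 'a, 'n::euclidean_space) atlas \<Rightarrow>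
    ('a \<Rightarrow> ('i \<Rightarrow> 'n) \<Rightarrow> real) \<Rightarrow> 'a \<Rightarrow> ('i \<Rightarrow> 'n) \<Rightarrow> ('i \<Rightarrow> 'n) \<Rightarrow> real" where
  "ext_deriv A \<omega> x y z = (let i = chart_at A x; p = chart_map A i x in
     dir_deriv (\<lambda>p. loc1 A \<omega> i p (z i)) p (y i) - dir_deriv (\<lambda>p. loc1 A \<omega> i p (y i)) p (z i))"

definition product_atlas :: "('i, 'a, 'n) atlas \<Rightarrow> ('i, real \<times> 'a, real \<times> 'n) atlas" where
  "product_atlas A = \<lparr>chart_index = chart_index A,
     chart_dom = (\<lambda>i. UNIV \<times> chart_dom A i),
     chart_map = (\<lambda>i (u, x). (u, chart_map A i x))\<rparr>"

text \<open>A domain of class \<open>C\<^sup>2\<close>: near each point of the topological boundary some \<open>C\<^sup>2\<close> chart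
  of the manifold straightens the closure to a half space and the boundary to its bounding
  hyperplane.\<close>

definition C2_domain ::
    "('i, 'a::topological_space, 'n::euclidean_space) atlas \<Rightarrow> 'a set \<Rightarrow> bool" where
  "C2_domain A D \<longleftrightarrow> open D \<and> connected D \<and>
     (\<forall>x\<in>frontier D. \<exists>U (\<kappa> :: 'a \<Rightarrow> 'n) e.
        x \<in> U \<and> open_embedding_on U \<kappa> \<and>
        (\<forall>i\<in>chart_index A.
           C_on 2 (transition U \<kappa> (chart_map A i)) (\<kappa> ` (U \<inter> chart_dom A i)) \<and>
           C_on 2 (transition (chart_dom A i) (chart_map A i) \<kappa>)
             (chart_map A i ` (U \<inter> chart_dom A i))) \<and>
        e \<noteq> 0 \<and>
        U \<inter> closure D = {z \<in> U. \<kappa> z \<bullet> e \<ge> 0} \<and>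
        U \<inter> frontier D = {z \<in> U. \<kappa> z \<bullet> e = 0})"

definition C2_defining_function ::
    "('i, 'a::topological_space, 'n::euclidean_space) atlas \<Rightarrow> 'a set \<Rightarrow> ('a \<Rightarrow> real) \<Rightarrow> bool" where
  "C2_defining_function A D \<phi> \<longleftrightarrow> C_manifold 2 A \<phi> \<and>
     {x. \<phi> x = 0} = frontier D \<and> (\<forall>x\<in>D. \<phi> x > 0) \<and>
     (\<forall>x\<in>frontier D. \<exists>y\<in>tangent_space A x. differential A \<phi> x y \<noteq> 0)"


section \<open>Riemannian metrics\<close>

definition riemannian_metric :: "('i, 'a, 'n::euclidean_space) atlas \<Rightarrow>
    ('a \<Rightarrow> ('i \<Rightarrow> 'n) \<Rightarrow> ('i \<Rightarrow> 'n) \<Rightarrow> real) \<Rightarrow> bool" where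
  "riemannian_metric A h \<longleftrightarrow>
     (\<forall>x. \<forall>y\<in>tangent_space A x. \<forall>z\<in>tangent_space A x. h x y z = h x z y) \<and>
     (\<forall>x. \<forall>y\<in>tangent_space A x - {\<lambda>_. 0}. h x y y > 0) \<and>
     (\<forall>i\<in>chart_index A. \<forall>p\<in>chart_map A i ` chart_dom A i. bilinear (loc2 A h i p)) \<and>
     (\<forall>i\<in>chart_index A. \<forall>a b.
        Cinf_on (\<lambda>p. loc2 A h i p a b) (chart_map A i ` chart_dom A i))"

definition one_form :: "('i, 'a, 'n::euclidean_space) atlas \<Rightarrow>
    ('a \<Rightarrow> ('i \<Rightarrow> 'n) \<Rightarrow> real) \<Rightarrow> bool" where
  "one_form A \<omega> \<longleftrightarrow>
     (\<forall>i\<in>chart_index A. \<forall>p\<in>chart_map A i ` chart_dom A i. linear (loc1 A \<omega> i p)) \<and>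
     (\<forall>i\<in>chart_index A. \<forall>a. Cinf_on (\<lambda>p. loc1 A \<omega> i p a) (chart_map A i ` chart_dom A i))"

definition gradient :: "('i, 'a, 'n::euclidean_space) atlas \<Rightarrow>
    ('a \<Rightarrow> ('i \<Rightarrow> 'n) \<Rightarrow> ('i \<Rightarrow> 'n) \<Rightarrow> real) \<Rightarrow> ('a \<Rightarrow> real) \<Rightarrow> 'a \<Rightarrow> 'i \<Rightarrow> 'n" where
  "gradient A h f x = (THE z. z \<in> tangent_space A x \<and>
     (\<forall>w\<in>tangent_space A x. h x z w = differential A f x w))"

definition riemann_hessian :: "('i, 'a, 'n::euclidean_space) atlas \<Rightarrow>
    ('a \<Rightarrow> ('i \<Rightarrow> 'n) \<Rightarrow> ('i \<Rightarrow> 'n) \<Rightarrow> real) \<Rightarrow> ('a \<Rightarrow> real) \<Rightarrow>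
    'a \<Rightarrow> ('i \<Rightarrow> 'n) \<Rightarrow> ('i \<Rightarrow> 'n) \<Rightarrow> real" where
  "riemann_hessian A h f x y z = (let i = chart_at A x; p = chart_map A i x in
     hessian_coord (christoffel (loc2 A h i) p) (f \<circ> chart_inv A i) p (y i) (z i))"


section \<open>The Chern connection of a Finsler metric\<close>

text \<open>Here \<open>F p \<eta>\<close> is a Finsler metric on an open subset of a Euclidean space, with \<open>p\<close> the
  base point and \<open>\<eta> \<noteq> 0\<close> the reference direction.\<close>

definition fundamental_tensor ::
    "('n::euclidean_space \<Rightarrow> 'n \<Rightarrow> real) \<Rightarrow> 'n \<Rightarrow> 'n \<Rightarrow> 'n \<Rightarrow> 'n \<Rightarrow> real" where
  "fundamental_tensor F \<eta> p a b =
     dir_deriv (\<lambda>\<eta>. dir_deriv (\<lambda>\<eta>. (F p \<eta>)\<^sup>2) \<eta> b) \<eta> a / 2"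

definition cartan_tensor ::
    "('n::euclidean_space \<Rightarrow> 'n \<Rightarrow> real) \<Rightarrow> 'n \<Rightarrow> 'n \<Rightarrow> 'n \<Rightarrow> 'n \<Rightarrow> 'n \<Rightarrow> real" where
  "cartan_tensor F \<eta> p a b c = dir_deriv (\<lambda>\<eta>. fundamental_tensor F \<eta> p a b) \<eta> c / 2"

text \<open>Nonlinear connection \<open>N\<^sup>i\<^sub>j = \<gamma>\<^sup>i\<^sub>j\<^sub>k \<eta>\<^sup>k - C\<^sup>i\<^sub>j\<^sub>k \<gamma>\<^sup>k\<^sub>r\<^sub>s \<eta>\<^sup>r \<eta>\<^sup>s\<close>, where \<open>\<gamma>\<close> are the formal
  Christoffel symbols of the fundamental tensor (reference direction kept constant).\<close>

definition nonlinear_connection ::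
    "('n::euclidean_space \<Rightarrow> 'n \<Rightarrow> real) \<Rightarrow> 'n \<Rightarrow> 'n \<Rightarrow> 'n \<Rightarrow> 'n" where
  "nonlinear_connection F \<eta> p a =
     (let g = fundamental_tensor F \<eta>; \<gamma> = christoffel g p in
      riesz (g p) (\<lambda>w. g p (\<gamma> a \<eta>) w - cartan_tensor F \<eta> p a (\<gamma> \<eta> \<eta>) w))"

text \<open>Horizontal derivative \<open>\<delta>\<^sub>a = \<partial>/\<partial>p\<^sup>a - N\<^sup>m\<^sub>a \<partial>/\<partial>\<eta>\<^sup>m\<close> of \<open>g(b,c)\<close>.\<close>

definition horizontal_deriv_g ::
    "('n::euclidean_space \<Rightarrow> 'n \<Rightarrow> real) \<Rightarrow> 'n \<Rightarrow> 'n \<Rightarrow> 'n \<Rightarrow> 'n \<Rightarrow> 'n \<Rightarrow> real" where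
  "horizontal_deriv_g F \<eta> p a b c =
     dir_deriv (\<lambda>p. fundamental_tensor F \<eta> p b c) p a
     - dir_deriv (\<lambda>\<eta>. fundamental_tensor F \<eta> p b c) \<eta> (nonlinear_connection F \<eta> p a)"

text \<open>Chern connection coefficients
  \<open>\<Gamma>\<^sup>k\<^sub>i\<^sub>j = g\<^sup>k\<^sup>l (\<delta>\<^sub>i g\<^sub>j\<^sub>l + \<delta>\<^sub>j g\<^sub>i\<^sub>l - \<delta>\<^sub>l g\<^sub>i\<^sub>j) / 2\<close>.\<close>

definition chern_coeff ::
    "('n::euclidean_space \<Rightarrow> 'n \<Rightarrow> real) \<Rightarrow> 'n \<Rightarrow> 'n \<Rightarrow> 'n \<Rightarrow> 'n \<Rightarrow> 'n" where
  "chern_coeff F \<eta> p a b = riesz (fundamental_tensor F \<eta> p)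
     (\<lambda>w. (horizontal_deriv_g F \<eta> p a b w + horizontal_deriv_g F \<eta> p b a w
           - horizontal_deriv_g F \<eta> p w a b) / 2)"

text \<open>\<open>chern_hessian A F f x \<eta> y z\<close> is \<open>(H\<^sub>f)\<^sub>\<eta>(y,z)\<close>.\<close>

definition chern_hessian :: "('i, 'a, 'n::euclidean_space) atlas \<Rightarrow>
    ('a \<Rightarrow> ('i \<Rightarrow> 'n) \<Rightarrow> real) \<Rightarrow> ('a \<Rightarrow> real) \<Rightarrow>
    'a \<Rightarrow> ('i \<Rightarrow> 'n) \<Rightarrow> ('i \<Rightarrow> 'n) \<Rightarrow> ('i \<Rightarrow> 'n) \<Rightarrow> real" where
  "chern_hessian A F f x \<eta> y z = (let i = chart_at A x; p = chart_map A i x in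
     hessian_coord (chern_coeff (loc1 A F i) (\<eta> i) p) (f \<circ> chart_inv A i) p (y i) (z i))"

definition infinitesimally_convex_at ::
    "('i, 'a::topological_space, 'n::euclidean_space) atlas \<Rightarrow> ('a \<Rightarrow> ('i \<Rightarrow> 'n) \<Rightarrow> real) \<Rightarrow>
     'a set \<Rightarrow> ('a \<Rightarrow> real) \<Rightarrow> 'a \<Rightarrow> bool" where
  "infinitesimally_convex_at A F N \<phi> x \<longleftrightarrow>
     (\<forall>y\<in>tangent_to A N x - {\<lambda>_. 0}. chern_hessian A F \<phi> x y y y \<le> 0)"

text \<open>\<open>N\<close> is the boundary and \<open>\<phi>\<close> the function that defines the domain.\<close>

definition infinitesimally_convex ::
    "('i, 'a::topological_space, 'n::euclidean_space) atlas \<Rightarrow> ('a \<Rightarrow> ('i \<Rightarrow> 'n) \<Rightarrow> real) \<Rightarrow>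
     'a set \<Rightarrow> ('a \<Rightarrow> real) \<Rightarrow> bool" where
  "infinitesimally_convex A F N \<phi> \<longleftrightarrow> (\<forall>x\<in>N. infinitesimally_convex_at A F N \<phi> x)"


section \<open>Randers spaces\<close>

definition form_norm :: "('i, 'a, 'n::euclidean_space) atlas \<Rightarrow>
    ('a \<Rightarrow> ('i \<Rightarrow> 'n) \<Rightarrow> ('i \<Rightarrow> 'n) \<Rightarrow> real) \<Rightarrow> ('a \<Rightarrow> ('i \<Rightarrow> 'n) \<Rightarrow> real) \<Rightarrow> 'a \<Rightarrow> real" where
  "form_norm A h \<omega> x = (SUP y\<in>tangent_space A x - {\<lambda>_. 0}. \<bar>\<omega> x y\<bar> / sqrt (h x y y))"

definition randers_space ::
    "('i, 'a::{t2_space,second_countable_topology}, 'n::euclidean_space) atlas \<Rightarrow>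
     ('a \<Rightarrow> ('i \<Rightarrow> 'n) \<Rightarrow> ('i \<Rightarrow> 'n) \<Rightarrow> real) \<Rightarrow> ('a \<Rightarrow> ('i \<Rightarrow> 'n) \<Rightarrow> real) \<Rightarrow> bool" where
  "randers_space A h \<omega> \<longleftrightarrow> smooth_manifold A \<and> riemannian_metric A h \<and> one_form A \<omega> \<and>
     (\<forall>x. form_norm A h \<omega> x < 1)"

definition randers_metric :: "('a \<Rightarrow> ('i \<Rightarrow> 'n) \<Rightarrow> ('i \<Rightarrow> 'n) \<Rightarrow> real) \<Rightarrow>
    ('a \<Rightarrow> ('i \<Rightarrow> 'n) \<Rightarrow> real) \<Rightarrow> 'a \<Rightarrow> ('i \<Rightarrow> 'n) \<Rightarrow> real" where
  "randers_metric h \<omega> x y = sqrt (h x y y) + \<omega> x y"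

text \<open>A tangent vector \<open>w\<close> of the product at \<open>(u,x)\<close> has components \<open>w i = (v, y i)\<close> in the
  product chart \<open>i\<close>, where \<open>v\<close> does not depend on the chart and \<open>y\<close> is tangent at \<open>x\<close>.\<close>

definition randers_beta :: "('i, 'a, 'n::euclidean_space) atlas \<Rightarrow>
    ('a \<Rightarrow> ('i \<Rightarrow> 'n) \<Rightarrow> ('i \<Rightarrow> 'n) \<Rightarrow> real) \<Rightarrow> ('a \<Rightarrow> ('i \<Rightarrow> 'n) \<Rightarrow> real) \<Rightarrow> ('a \<Rightarrow> real) \<Rightarrow>
    real \<times> 'a \<Rightarrow> ('i \<Rightarrow> real \<times> 'n) \<Rightarrow> real" where
  "randers_beta A h \<omega> \<beta> = (\<lambda>(u, x) w.
     let v = fst (w (chart_at A x)); y = (\<lambda>i. snd (w i)) in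
     sqrt (h x y y + v\<^sup>2 / \<beta> x) + \<omega> x y)"

end

theory Submission
  imports Defs
begin

text \<open>
  Everything is computed in one chart. For a Randers metric \<open>F = sqrt h + \<omega>\<close>, homogeneity makes the
  nonlinear connection drop out of the Chern coefficients \<open>\<Gamma>(\<eta>, \<eta>)\<close> in the reference direction:
  they are the formal Christoffel symbols of the fundamental tensor, and turn out to be the
  Christoffel symbols of \<open>h\<close>, plus \<open>sqrt (h(\<eta>, \<eta>)) z\<close> with \<open>h(z, w) = d\<omega>(\<eta>, w)\<close>, plus a multiple
  of \<open>\<eta>\<close> (\<open>chern_coeff_randers\<close>). Since \<open>d\<phi>\<close> annihilates vectors tangent to the boundary, for such \<open>y\<close>
  the Finslerian Hessian \<open>(H\<^sub>\<phi>)\<^sub>y(y, y)\<close> is \<open>H(y, y) - sqrt (h(y, y)) d\<omega>(y, \<nabla>\<phi>)\<close>, where \<open>H\<close> is the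
  Hessian for \<open>h\<close>. Tangent vectors can be reversed, which gives the absolute value in the
  characterization of infinitesimal convexity (\<open>convex_iff\<close>).

  The same formula applies to the product, with the metric \<open>h + du\<^sup>2 / \<beta>\<close> and the pullback of \<open>\<omega>\<close>. The
  only new Christoffel term that \<open>d\<phi>\<close> sees is \<open>v\<^sup>2 \<nabla>\<beta> / (2 \<beta>\<^sup>2)\<close>, so that convexity of the product
  says that
  \<open>H(y, y) - v\<^sup>2 h(\<nabla>\<phi>, \<nabla>\<beta>) / (2 \<beta>\<^sup>2) + sqrt (h(y, y) + v\<^sup>2 / \<beta>) \<bar>d\<omega>(y, \<nabla>\<phi>)\<bar> \<le> 0\<close>
  for all numbers \<open>v\<close> and all \<open>y\<close> tangent to the boundary (\<open>product_convex_iff\<close>). This is a quadratic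
  polynomial in the length \<open>s = sqrt (h(y, y) + v\<^sup>2 / \<beta>)\<close>, and maximizing it over
  \<open>s \<ge> sqrt (h(y, y))\<close> gives the three conditions (\<open>warped_convexity_iff\<close>).
\<close>

section \<open>Directional derivatives\<close>

lemma dir_deriv_cong:
  assumes "open U" "p \<in> U" "\<And>q. q \<in> U \<Longrightarrow> f q = f' q"
  shows "dir_deriv f p = dir_deriv f' p"
proof -
  have "(f has_derivative f1) (at p) \<longleftrightarrow> (f' has_derivative f1) (at p)" for f1
    using assms by (metis has_derivative_transform_within_open)
  then show ?thesis by (simp add: frechet_derivative_def)
qed

lemma dir_deriv_eq: "(f has_derivative f') (at p) \<Longrightarrow> dir_deriv f p a = f' a"
  by (metis frechet_derivative_at)

lemma linear_dir_deriv:
  "f differentiable (at p) \<Longrightarrow> linear (dir_deriv f p)"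
  by (rule linear_frechet_derivative)

lemma has_derivative_dir_deriv:
  "f differentiable (at p) \<Longrightarrow> (f has_derivative dir_deriv f p) (at p)"
  by (simp add: frechet_derivative_works)

text \<open>The derivative of a family of linear forms in a fixed direction is again a linear form.\<close>
lemma linear_dir_deriv_param:
  fixes f :: "'n::euclidean_space \<Rightarrow> 'm::real_vector \<Rightarrow> real"
  assumes U: "open U" "p \<in> U"
    and lin: "\<And>q. q \<in> U \<Longrightarrow> linear (f q)"
    and diff: "\<And>w. (\<lambda>q. f q w) differentiable (at p)"
  shows "linear (\<lambda>w. dir_deriv (\<lambda>q. f q w) p a)"
proof (rule linearI)
  fix v w :: 'm and c :: real
  note D = has_derivative_dir_deriv[OF diff]
  have "dir_deriv (\<lambda>q. f q (v + w)) p = dir_deriv (\<lambda>q. f q v + f q w) p"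
    by (rule dir_deriv_cong[OF U]) (simp add: linear_add[OF lin])
  then show "dir_deriv (\<lambda>q. f q (v + w)) p a = dir_deriv (\<lambda>q. f q v) p a + dir_deriv (\<lambda>q. f q w) p a"
    using dir_deriv_eq[OF has_derivative_add[OF D D]] by simp
  have "dir_deriv (\<lambda>q. f q (c *\<^sub>R w)) p = dir_deriv (\<lambda>q. c *\<^sub>R f q w) p"
    by (rule dir_deriv_cong[OF U]) (simp add: linear_cmul[OF lin])
  then show "dir_deriv (\<lambda>q. f q (c *\<^sub>R w)) p a = c *\<^sub>R dir_deriv (\<lambda>q. f q w) p a"
    using dir_deriv_eq[OF has_derivative_scaleR_right[OF D]] by metis
qed

lemma has_derivative_compose_snd:
  fixes f :: "'n::euclidean_space \<Rightarrow> 'm::real_normed_vector"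
  assumes "f differentiable (at (snd q))"
  shows "((\<lambda>q :: 'k::euclidean_space \<times> 'n. f (snd q)) has_derivative (\<lambda>a. dir_deriv f (snd q) (snd a))) (at q)"
  using has_derivative_dir_deriv[OF assms]
  by (rule has_derivative_compose[OF has_derivative_snd[OF has_derivative_ident]])

lemma dir_deriv_compose_snd:
  fixes f :: "'n::euclidean_space \<Rightarrow> 'm::real_normed_vector"
  assumes "f differentiable (at (snd q))"
  shows "dir_deriv (\<lambda>q :: 'k::euclidean_space \<times> 'n. f (snd q)) q a = dir_deriv f (snd q) (snd a)"
  by (rule dir_deriv_eq[OF has_derivative_compose_snd[OF assms]])

lemma hessian_coord_cong:
  assumes "open U" "p \<in> U" "\<And>q. q \<in> U \<Longrightarrow> f q = f' q"
  shows "hessian_coord \<Gamma> f p a b = hessian_coord \<Gamma> f' p a b"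
proof -
  have d: "dir_deriv f q = dir_deriv f' q" if "q \<in> U" for q
    by (rule dir_deriv_cong[OF assms(1) that assms(3)])
  have "dir_deriv (\<lambda>q. dir_deriv f q b) p = dir_deriv (\<lambda>q. dir_deriv f' q b) p"
    by (rule dir_deriv_cong[OF assms(1,2)]) (simp add: d)
  then show ?thesis by (simp add: hessian_coord_def d assms)
qed

section \<open>Scalar products\<close>

text \<open>A symmetric positive definite bilinear form. It represents every linear form by exactly one
  vector, so that the definite description in \<^const>\<open>riesz\<close> denotes on linear forms.\<close>
locale scalar_product =
  fixes g :: "'n::euclidean_space \<Rightarrow> 'n \<Rightarrow> real"
  assumes bilin: "bilinear g"
    and sym: "g a b = g b a"
    and pos: "a \<noteq> 0 \<Longrightarrow> g a a > 0"
begin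

lemma bounded_bilin: "bounded_bilinear g"
  using bilin by (simp add: bilinear_conv_bounded_bilinear)

lemmas g_simps [simp] =
  bilinear_ladd[OF bilin] bilinear_radd[OF bilin] bilinear_lmul[OF bilin] bilinear_rmul[OF bilin]
  bilinear_lneg[OF bilin] bilinear_rneg[OF bilin] bilinear_lsub[OF bilin] bilinear_rsub[OF bilin]
  bilinear_lzero[OF bilin] bilinear_rzero[OF bilin]

lemma linear_right: "linear (g a)"
  using bilin by (auto simp: bilinear_def)

lemma linear_left: "linear (\<lambda>a. g a b)"
  using bilin by (auto simp: bilinear_def)

lemma nonneg: "g a a \<ge> 0"
  using pos[of a] by (cases "a = 0") auto

lemma eq_zeroI: "g a a = 0 \<Longrightarrow> a = 0"
  using pos[of a] by force

lemma unique_repr: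
  assumes "\<And>w. g z w = g z' w"
  shows "z = z'"
  using assms[of "z - z'"] eq_zeroI[of "z - z'"] by simp

text \<open>The vector of the values \<open>g z b\<close> on the standard basis depends linearly and injectively on \<open>z\<close>,
  hence surjectively because the dimension is finite.\<close>
lemma repr_exists:
  assumes "linear f"
  shows "\<exists>z. \<forall>w. g z w = f w"
proof -
  let ?T = "\<lambda>z. \<Sum>b\<in>Basis. g z b *\<^sub>R b"
  have lin: "linear ?T"
    by (rule linearI) (simp_all add: scaleR_left_distrib sum.distrib scaleR_sum_right)
  have T: "?T z \<bullet> w = g z w" for z w
  proof -
    have "?T z \<bullet> w = (\<Sum>b\<in>Basis. g z ((w \<bullet> b) *\<^sub>R b))"
      by (simp add: inner_sum_left) (simp add: inner_commute mult.commute)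
    also have "\<dots> = g z (\<Sum>b\<in>Basis. (w \<bullet> b) *\<^sub>R b)"
      by (rule linear_sum[OF linear_right, symmetric])
    finally show ?thesis by (simp add: euclidean_representation)
  qed
  have "inj ?T"
  proof (rule injI)
    fix z z' assume "?T z = ?T z'"
    then show "z = z'" using T by (intro unique_repr) metis
  qed
  with lin have "surj ?T" by (rule linear_inj_imp_surj)
  from surjD[OF this, of "adjoint f 1"] obtain z where z: "?T z = adjoint f 1" by auto
  have "g z w = f w" for w
    using T[of z w] adjoint_works[OF assms, of w 1] by (simp add: z inner_commute)
  then show ?thesis by blast
qed

lemma riesz_eqI:
  assumes "\<And>w. g z w = f w"
  shows "riesz g f = z"
  unfolding riesz_def using assms unique_repr by (intro the_equality) metis+

lemma riesz_works:
  assumes "linear f"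
  shows "g (riesz g f) w = f w"
  using repr_exists[OF assms] riesz_eqI by metis

lemma cauchy_schwarz: "(g a b)\<^sup>2 \<le> g a a * g b b"
proof (cases "b = 0")
  case False
  have "0 \<le> g (g b b *\<^sub>R a - g a b *\<^sub>R b) (g b b *\<^sub>R a - g a b *\<^sub>R b)" by (rule nonneg)
  also have "\<dots> = g b b * (g a a * g b b - (g a b)\<^sup>2)"
    using sym[of b a] by (simp add: algebra_simps power2_eq_square)
  finally show ?thesis using pos[OF False] by (simp add: zero_le_mult_iff)
qed simp

end

section \<open>Randers norms on a vector space\<close>

text \<open>The Randers norm \<open>F \<eta> = sqrt (g \<eta> \<eta>) + \<omega> \<eta>\<close> of a scalar product and a linear form.\<close>
definition randers_fn :: "('n \<Rightarrow> 'n \<Rightarrow> real) \<Rightarrow> ('n \<Rightarrow> real) \<Rightarrow> 'n \<Rightarrow> real" where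
  "randers_fn g \<omega> \<eta> = sqrt (g \<eta> \<eta>) + \<omega> \<eta>"

text \<open>The differential \<open>l \<eta>\<close> of the Randers norm at \<open>\<eta> \<noteq> 0\<close>, evaluated at \<open>a\<close>.\<close>
definition randers_diff :: "('n \<Rightarrow> 'n \<Rightarrow> real) \<Rightarrow> ('n \<Rightarrow> real) \<Rightarrow> 'n \<Rightarrow> 'n \<Rightarrow> real" where
  "randers_diff g \<omega> \<eta> a = g \<eta> a / sqrt (g \<eta> \<eta>) + \<omega> a"

text \<open>The Hessian \<open>m \<eta>\<close> of \<open>sqrt (g \<eta> \<eta>)\<close> at \<open>\<eta> \<noteq> 0\<close>, evaluated at \<open>a\<close> and \<open>b\<close>. It is also the Hessian
  of the Randers norm, since the one-form is linear, and its kernel is spanned by \<open>\<eta>\<close>.\<close>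
definition angular :: "('n \<Rightarrow> 'n \<Rightarrow> real) \<Rightarrow> 'n \<Rightarrow> 'n \<Rightarrow> 'n \<Rightarrow> real" where
  "angular g \<eta> a b = g a b / sqrt (g \<eta> \<eta>) - g \<eta> a * g \<eta> b / sqrt (g \<eta> \<eta>) ^ 3"

text \<open>The bound on \<open>\<omega>\<close> makes \<open>F\<close> positive away from 0, and the fundamental tensor nondegenerate.\<close>
locale randers_norm = scalar_product g
  for g :: "'n::euclidean_space \<Rightarrow> 'n \<Rightarrow> real" +
  fixes \<omega> :: "'n \<Rightarrow> real"
  assumes lin: "linear \<omega>"
    and bound: "a \<noteq> 0 \<Longrightarrow> \<bar>\<omega> a\<bar> < sqrt (g a a)"
begin

abbreviation "F \<equiv> randers_fn g \<omega>"
abbreviation "l \<equiv> randers_diff g \<omega>"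
abbreviation "m \<equiv> angular g"

lemmas \<omega>_simps [simp] = linear_add[OF lin] linear_cmul[OF lin] linear_0[OF lin]
  linear_neg[OF lin] linear_diff[OF lin]

lemma sqrt_pos: "\<eta> \<noteq> 0 \<Longrightarrow> sqrt (g \<eta> \<eta>) > 0"
  using pos by simp

lemma F_pos: "\<eta> \<noteq> 0 \<Longrightarrow> F \<eta> > 0"
  using bound[of \<eta>] by (simp add: randers_fn_def)

lemma div_sqrt: "\<eta> \<noteq> 0 \<Longrightarrow> g \<eta> \<eta> / sqrt (g \<eta> \<eta>) = sqrt (g \<eta> \<eta>)"
  using nonneg by (simp add: real_div_sqrt)

lemma l_self: "\<eta> \<noteq> 0 \<Longrightarrow> l \<eta> \<eta> = F \<eta>"
  by (simp add: randers_diff_def randers_fn_def div_sqrt)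

lemma m_self:
  assumes "\<eta> \<noteq> 0"
  shows "m \<eta> \<eta> a = 0" "m \<eta> a \<eta> = 0"
proof -
  have "A / s - s ^ 2 * A / s ^ 3 = 0" if "s \<noteq> 0" for s A :: real
    using that by (simp add: field_simps power2_eq_square power3_eq_cube)
  from this[of "sqrt (g \<eta> \<eta>)"] show "m \<eta> \<eta> a = 0"
    using sqrt_pos[OF assms] nonneg[of \<eta>] by (simp add: angular_def)
  then show "m \<eta> a \<eta> = 0"
    by (simp only: angular_def sym[of a \<eta>] mult.commute)
qed

lemma m_sym: "m \<eta> a b = m \<eta> b a"
  by (simp add: angular_def sym[of a b])

lemma has_derivative_quad:
  "((\<lambda>\<eta>. g \<eta> \<eta>) has_derivative (\<lambda>c. 2 * g \<eta> c)) (at \<eta>)"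
proof -
  have "((\<lambda>\<eta>. g \<eta> \<eta>) has_derivative (\<lambda>c. g \<eta> c + g c \<eta>)) (at \<eta>)"
    by (rule bounded_bilinear.FDERIV[OF bounded_bilin]) (auto intro: derivative_intros)
  then show ?thesis by (simp add: sym[of _ \<eta>])
qed

lemma has_derivative_\<omega>: "(\<omega> has_derivative \<omega>) (at \<eta>)"
  using lin by (intro bounded_linear_imp_has_derivative) (simp add: linear_conv_bounded_linear)

lemma has_derivative_left: "((\<lambda>\<eta>. g \<eta> b) has_derivative (\<lambda>c. g c b)) (at \<eta>)"
  using linear_left by (intro bounded_linear_imp_has_derivative) (simp add: linear_conv_bounded_linear)

lemma has_derivative_sqrt:
  assumes "\<eta> \<noteq> 0"
  shows "((\<lambda>\<eta>. sqrt (g \<eta> \<eta>)) has_derivative (\<lambda>c. g \<eta> c / sqrt (g \<eta> \<eta>))) (at \<eta>)"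
  using has_derivative_real_sqrt[OF pos[OF assms] has_derivative_quad]
  by (simp add: field_simps)

lemma has_derivative_F:
  assumes "\<eta> \<noteq> 0"
  shows "(F has_derivative l \<eta>) (at \<eta>)"
  unfolding randers_fn_def[abs_def] randers_diff_def[abs_def]
  by (intro has_derivative_add has_derivative_sqrt has_derivative_\<omega> assms)

lemma has_derivative_l:
  assumes "\<eta> \<noteq> 0"
  shows "((\<lambda>\<eta>. l \<eta> b) has_derivative (\<lambda>c. m \<eta> b c)) (at \<eta>)"
proof -
  have s: "sqrt (g \<eta> \<eta>) \<noteq> 0" using sqrt_pos[OF assms] by simp
  have "((\<lambda>\<eta>. l \<eta> b) has_derivative
      (\<lambda>c. (g c b * sqrt (g \<eta> \<eta>) - g \<eta> b * (g \<eta> c / sqrt (g \<eta> \<eta>))) /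
            (sqrt (g \<eta> \<eta>) * sqrt (g \<eta> \<eta>)) + 0)) (at \<eta>)"
    unfolding randers_diff_def
    by (intro has_derivative_add has_derivative_divide' has_derivative_left has_derivative_sqrt
        has_derivative_const assms s)
  then show ?thesis
  proof (rule has_derivative_eq_rhs)
    have "(C * s - A * (B / s)) / (s * s) + 0 = C / s - A * B / s ^ 3" if "s \<noteq> 0" for s A B C :: real
      using that by (simp add: field_simps power3_eq_cube)
    from this[OF s]
    show "(\<lambda>c. (g c b * sqrt (g \<eta> \<eta>) - g \<eta> b * (g \<eta> c / sqrt (g \<eta> \<eta>))) /
            (sqrt (g \<eta> \<eta>) * sqrt (g \<eta> \<eta>)) + 0) = m \<eta> b"
      by (simp only: fun_eq_iff angular_def sym[of b] simp_thms)
  qed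
qed

text \<open>Only the reference direction \<open>\<eta>'\<close> varies here; the argument \<open>\<eta>\<close> stays fixed. Since \<open>m \<eta>' \<eta>' w = 0\<close>
  for all \<open>\<eta>'\<close>, the product rule leaves the angular form itself, with a minus sign.\<close>
lemma has_derivative_m_self:
  assumes "\<eta> \<noteq> 0"
  shows "((\<lambda>\<eta>'. m \<eta>' \<eta> w) has_derivative (\<lambda>c. - m \<eta> w c)) (at \<eta>)"
proof -
  let ?s = "sqrt (g \<eta> \<eta>)"
  have s: "?s \<noteq> 0" "?s ^ 3 \<noteq> 0" using sqrt_pos[OF assms] by simp_all
  have q: "g \<eta> \<eta> = ?s ^ 2" using nonneg by simp
  have "((\<lambda>\<eta>'. m \<eta>' \<eta> w) has_derivative
      (\<lambda>c. (0 * ?s - g \<eta> w * (g \<eta> c / ?s)) / (?s * ?s) -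
           ((g \<eta> \<eta> * g c w + g c \<eta> * g \<eta> w) * ?s ^ 3 -
            (g \<eta> \<eta> * g \<eta> w) * (of_nat 3 * (g \<eta> c / ?s) * ?s ^ (3 - 1))) / (?s ^ 3 * ?s ^ 3))) (at \<eta>)"
    unfolding angular_def
    by (intro has_derivative_diff has_derivative_divide' has_derivative_mult has_derivative_power
        has_derivative_left has_derivative_sqrt has_derivative_const assms s)
  moreover have "(0 * ?s - g \<eta> w * (g \<eta> c / ?s)) / (?s * ?s) -
      ((g \<eta> \<eta> * g c w + g c \<eta> * g \<eta> w) * ?s ^ 3 -
       (g \<eta> \<eta> * g \<eta> w) * (of_nat 3 * (g \<eta> c / ?s) * ?s ^ (3 - 1))) / (?s ^ 3 * ?s ^ 3)
      = - m \<eta> w c" for c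
  proof -
    have "(0 * s - A * (B / s)) / (s * s) -
        ((s ^ 2 * C + B * A) * s ^ 3 - (s ^ 2 * A) * (of_nat 3 * (B / s) * s ^ (3 - 1))) / (s ^ 3 * s ^ 3)
        = - (C / s - A * B / s ^ 3)" if "s \<noteq> 0" for s A B C :: real
      using that by (simp add: field_simps power2_eq_square power3_eq_cube)
    from this[OF s(1), of "g \<eta> w" "g \<eta> c" "g w c"] show ?thesis
      unfolding angular_def q[symmetric] sym[of c \<eta>] sym[of c w] .
  qed
  ultimately show ?thesis by (simp only:)
qed

lemma dir_deriv_F_sq:
  assumes "\<eta> \<noteq> 0"
  shows "dir_deriv (\<lambda>\<eta>. (F \<eta>)\<^sup>2) \<eta> b = 2 * F \<eta> * l \<eta> b"
proof -
  have "((\<lambda>\<eta>. (F \<eta>)\<^sup>2) has_derivative (\<lambda>c. 2 * F \<eta> * l \<eta> c)) (at \<eta>)"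
    by (rule derivative_eq_intros has_derivative_F assms refl)+ (simp add: fun_eq_iff)
  then show ?thesis by (metis frechet_derivative_at)
qed

lemma fundamental_tensor_randers:
  assumes "\<eta> \<noteq> 0" "\<Phi> p = F"
  shows "fundamental_tensor \<Phi> \<eta> p a b = l \<eta> a * l \<eta> b + F \<eta> * m \<eta> a b"
proof -
  have "dir_deriv (\<lambda>\<eta>. dir_deriv (\<lambda>\<eta>. (\<Phi> p \<eta>)\<^sup>2) \<eta> b) \<eta> = dir_deriv (\<lambda>\<eta>. 2 * F \<eta> * l \<eta> b) \<eta>"
    by (rule dir_deriv_cong[of "- {0}"]) (auto simp: assms dir_deriv_F_sq)
  moreover have "((\<lambda>\<eta>. 2 * F \<eta> * l \<eta> b) has_derivative
      (\<lambda>c. 2 * (l \<eta> c * l \<eta> b + F \<eta> * m \<eta> b c))) (at \<eta>)"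
    apply (rule derivative_eq_intros has_derivative_F has_derivative_l assms refl)+
    apply (simp add: algebra_simps)
    done
  ultimately show ?thesis
    by (simp add: fundamental_tensor_def dir_deriv_eq m_sym[of \<eta> a])
qed

lemma fundamental_tensor_self:
  assumes "\<eta> \<noteq> 0" "\<Phi> p = F"
  shows "fundamental_tensor \<Phi> \<eta> p \<eta> b = F \<eta> * l \<eta> b"
  using assms by (simp add: fundamental_tensor_randers m_self l_self)

lemma l_linear: "linear (l \<eta>)"
  by (rule linearI) (simp_all add: randers_diff_def algebra_simps add_divide_distrib)

lemma m_linear: "linear (m \<eta> a)"
  by (rule linearI) (simp_all add: angular_def algebra_simps add_divide_distrib)

lemma angular_eq_0D:
  assumes "\<eta> \<noteq> 0" and "m \<eta> a a = 0"
  shows "\<exists>c. a = c *\<^sub>R \<eta>"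
proof
  let ?c = "g \<eta> a / g \<eta> \<eta>"
  let ?b = "a - ?c *\<^sub>R \<eta>"
  have nz: "g \<eta> \<eta> > 0" using assms pos by simp
  have "A * s ^ 2 = B * B" if "A / s - B * B / s ^ 3 = 0" "s > 0" for A B s :: real
    using that by (simp add: field_simps power2_eq_square power3_eq_cube)
  from this[OF assms(2)[unfolded angular_def] sqrt_pos[OF assms(1)]]
  have "g a a * g \<eta> \<eta> = g \<eta> a * g \<eta> a"
    using nonneg[of \<eta>] by simp
  moreover have "g ?b ?b * g \<eta> \<eta> = g a a * g \<eta> \<eta> - g \<eta> a * g \<eta> a"
    using nz sym[of a \<eta>] by (simp add: algebra_simps)
  ultimately have "g ?b ?b = 0" using nz by simp
  then show "a = ?c *\<^sub>R \<eta>" using eq_zeroI by fastforce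
qed

text \<open>Nondegeneracy. If \<open>a\<close> is in the kernel, then pairing with \<open>\<eta>\<close> gives \<open>l \<eta> a = 0\<close>, then pairing with
  \<open>a\<close> gives \<open>m \<eta> a a = 0\<close>, so \<open>a\<close> is a multiple of \<open>\<eta>\<close>, on which \<open>l \<eta>\<close> is injective.\<close>
lemma fundamental_tensor_unique:
  assumes "\<eta> \<noteq> 0" "\<Phi> p = F"
    and eq: "\<And>w. fundamental_tensor \<Phi> \<eta> p z w = fundamental_tensor \<Phi> \<eta> p z' w"
  shows "z = z'"
proof -
  let ?a = "z - z'"
  have sub: "l \<eta> ?a * l \<eta> w + F \<eta> * m \<eta> ?a w = 0" for w
    using eq[of w]
    by (simp add: fundamental_tensor_randers[where \<Phi> = \<Phi>, OF assms(1,2)] m_sym[of \<eta> _ w]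
        linear_diff[OF l_linear] linear_diff[OF m_linear] algebra_simps)
  have l0: "l \<eta> ?a = 0"
    using sub[of \<eta>] assms F_pos[OF assms(1)] by (simp add: m_self l_self)
  have "m \<eta> ?a ?a = 0" using sub[of ?a] l0 F_pos[OF assms(1)] by simp
  then obtain c where c: "?a = c *\<^sub>R \<eta>" using angular_eq_0D assms(1) by blast
  then have "c * F \<eta> = 0"
    using l0 linear_cmul[OF l_linear[of \<eta>], of c \<eta>] by (simp add: l_self assms)
  then show ?thesis using c F_pos[OF assms(1)] by simp
qed

text \<open>The Cartan tensor vanishes when one of its arguments is the reference direction. This is what
  makes the nonlinear connection disappear from \<open>\<Gamma>(\<eta>, \<eta>)\<close>.\<close>
lemma dir_deriv_fundamental_tensor_self:
  assumes "\<eta> \<noteq> 0" "\<Phi> p = F"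
  shows "dir_deriv (\<lambda>\<eta>'. fundamental_tensor \<Phi> \<eta>' p \<eta> w) \<eta> c = 0"
proof -
  have "dir_deriv (\<lambda>\<eta>'. fundamental_tensor \<Phi> \<eta>' p \<eta> w) \<eta> =
      dir_deriv (\<lambda>\<eta>'. l \<eta>' \<eta> * l \<eta>' w + F \<eta>' * m \<eta>' \<eta> w) \<eta>"
    by (rule dir_deriv_cong[of "- {0}"]) (auto simp: assms fundamental_tensor_randers)
  moreover have "((\<lambda>\<eta>'. l \<eta>' \<eta> * l \<eta>' w + F \<eta>' * m \<eta>' \<eta> w) has_derivative
      (\<lambda>c. (l \<eta> \<eta> * m \<eta> w c + m \<eta> \<eta> c * l \<eta> w) +
           (F \<eta> * - m \<eta> w c + l \<eta> c * m \<eta> \<eta> w))) (at \<eta>)"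
    by (intro has_derivative_add has_derivative_mult has_derivative_F has_derivative_l
        has_derivative_m_self assms)
  ultimately show ?thesis
    by (simp add: dir_deriv_eq l_self m_self assms)
qed

end

section \<open>The Chern connection of a Randers metric in coordinates\<close>

text \<open>The exterior derivative of a one-form on an open subset of a Euclidean space, with the
  normalization of \<^const>\<open>ext_deriv\<close>.\<close>
definition ext_deriv_coord :: "('n::euclidean_space \<Rightarrow> 'n \<Rightarrow> real) \<Rightarrow> 'n \<Rightarrow> 'n \<Rightarrow> 'n \<Rightarrow> real" where
  "ext_deriv_coord \<omega> p a b = dir_deriv (\<lambda>p. \<omega> p b) p a - dir_deriv (\<lambda>p. \<omega> p a) p b"

text \<open>A Randers metric on an open subset \<open>U\<close> of a Euclidean space: a Randers norm at each point, with
  coefficients that are differentiable in the base point. First derivatives in the base point are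
  all that the connection coefficients involve.\<close>
locale randers_field =
  fixes U :: "'n::euclidean_space set" and g :: "'n \<Rightarrow> 'n \<Rightarrow> 'n \<Rightarrow> real" and \<omega> :: "'n \<Rightarrow> 'n \<Rightarrow> real"
  assumes open_U: "open U"
    and norm: "p \<in> U \<Longrightarrow> randers_norm (g p) (\<omega> p)"
    and diff_g: "p \<in> U \<Longrightarrow> (\<lambda>p. g p a b) differentiable (at p)"
    and diff_\<omega>: "p \<in> U \<Longrightarrow> (\<lambda>p. \<omega> p a) differentiable (at p)"
begin

lemma scalar_product: "p \<in> U \<Longrightarrow> scalar_product (g p)"
  using norm by (simp add: randers_norm_def)

lemma linear_christoffel_form:
  assumes "p \<in> U"
  shows "linear (\<lambda>w. (dir_deriv (\<lambda>p. g p b w) p a + dir_deriv (\<lambda>p. g p a w) p b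
           - dir_deriv (\<lambda>p. g p a b) p w) / 2)"
proof -
  have "linear (\<lambda>w. (1 / 2) *\<^sub>R (dir_deriv (\<lambda>p. g p b w) p a + dir_deriv (\<lambda>p. g p a w) p b
           - dir_deriv (\<lambda>p. g p a b) p w))"
    by (intro linear_compose_scale_right linear_compose_add linear_compose_sub linear_dir_deriv
        linear_dir_deriv_param[OF open_U] scalar_product.linear_right scalar_product diff_g assms)
  then show ?thesis by simp
qed

lemma christoffel_works:
  assumes "p \<in> U"
  shows "g p (christoffel g p a b) w = (dir_deriv (\<lambda>p. g p b w) p a + dir_deriv (\<lambda>p. g p a w) p b
           - dir_deriv (\<lambda>p. g p a b) p w) / 2"
  unfolding christoffel_def
  by (rule scalar_product.riesz_works[OF scalar_product linear_christoffel_form]) (fact assms)+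

lemma linear_ext_deriv_coord:
  assumes "p \<in> U"
  shows "linear (ext_deriv_coord \<omega> p a)"
  unfolding ext_deriv_coord_def
  by (intro linear_compose_sub linear_dir_deriv linear_dir_deriv_param[OF open_U]
      randers_norm.lin[OF norm] diff_\<omega> assms)

text \<open>The nonlinear connection only enters through derivatives of \<open>g(\<eta>, w)\<close> in the reference
  direction, which vanish. What remains are the formal Christoffel symbols of the fundamental
  tensor, where \<open>g(\<eta>, w) = F \<cdot> l w\<close> and \<open>g(\<eta>, \<eta>) = F\<^sup>2\<close>.\<close>
lemma chern_coeff_form:
  assumes \<Phi>: "\<And>q. q \<in> U \<Longrightarrow> \<Phi> q = randers_fn (g q) (\<omega> q)" and p: "p \<in> U" and "\<eta> \<noteq> 0"
  shows "chern_coeff \<Phi> \<eta> p \<eta> \<eta> = riesz (fundamental_tensor \<Phi> \<eta> p) (\<lambda>w.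
    dir_deriv (\<lambda>q. randers_fn (g q) (\<omega> q) \<eta> * randers_diff (g q) (\<omega> q) \<eta> w) p \<eta>
    - dir_deriv (\<lambda>q. (randers_fn (g q) (\<omega> q) \<eta>)\<^sup>2) p w / 2)"
proof -
  have G: "fundamental_tensor \<Phi> \<eta> q \<eta> w = randers_fn (g q) (\<omega> q) \<eta> * randers_diff (g q) (\<omega> q) \<eta> w"
    if "q \<in> U" for q w
    using randers_norm.fundamental_tensor_self[OF norm] that \<Phi> \<open>\<eta> \<noteq> 0\<close> by blast
  have H: "horizontal_deriv_g \<Phi> \<eta> p a \<eta> w =
      dir_deriv (\<lambda>q. randers_fn (g q) (\<omega> q) \<eta> * randers_diff (g q) (\<omega> q) \<eta> w) p a" for a w
    unfolding horizontal_deriv_g_def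
    using dir_deriv_cong[OF open_U p G]
      randers_norm.dir_deriv_fundamental_tensor_self[where \<Phi> = \<Phi>, OF norm, OF p \<open>\<eta> \<noteq> 0\<close> \<Phi>[OF p]]
    by simp
  have "dir_deriv (\<lambda>q. randers_fn (g q) (\<omega> q) \<eta> * randers_diff (g q) (\<omega> q) \<eta> \<eta>) p =
      dir_deriv (\<lambda>q. (randers_fn (g q) (\<omega> q) \<eta>)\<^sup>2) p"
    by (rule dir_deriv_cong[OF open_U p])
      (simp add: randers_norm.l_self[OF norm] \<open>\<eta> \<noteq> 0\<close> power2_eq_square)
  then show ?thesis by (simp add: chern_coeff_def H diff_divide_distrib)
qed

text \<open>In the direction \<open>\<eta>\<close>, the Chern coefficients of the Randers metric are the Christoffel symbols
  of \<open>g\<close>, plus the Lorentz force \<open>sqrt (g(\<eta>, \<eta>)) z\<close> with \<open>g(z, w) = d\<omega>(\<eta>, w)\<close>, plus a multiple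
  of \<open>\<eta>\<close>, which only affects the parametrization of geodesics.\<close>
theorem chern_coeff_randers:
  assumes \<Phi>: "\<And>q. q \<in> U \<Longrightarrow> \<Phi> q = randers_fn (g q) (\<omega> q)" and p: "p \<in> U" and nz: "\<eta> \<noteq> 0"
  shows "\<exists>c. chern_coeff \<Phi> \<eta> p \<eta> \<eta> = christoffel g p \<eta> \<eta>
    + sqrt (g p \<eta> \<eta>) *\<^sub>R riesz (g p) (ext_deriv_coord \<omega> p \<eta>) + c *\<^sub>R \<eta>"
proof -
  interpret randers_norm "g p" "\<omega> p" by (rule norm[OF p])
  define s where "s = sqrt (g p \<eta> \<eta>)"
  define z where "z = riesz (g p) (ext_deriv_coord \<omega> p \<eta>)"
  define \<Gamma> where "\<Gamma> = christoffel g p \<eta> \<eta>"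
  define dg where "dg w = dir_deriv (\<lambda>q. g q \<eta> w) p" for w
  define d\<omega> where "d\<omega> w = dir_deriv (\<lambda>q. \<omega> q w) p" for w
  define dF where "dF a = dg \<eta> a / (2 * s) + d\<omega> \<eta> a" for a
  define dl where "dl w a = (dg w a * s - g p \<eta> w * (dg \<eta> a / (2 * s))) / (s * s) + d\<omega> w a" for w a
  \<comment> \<open>The coefficient that makes \<open>l \<eta> X = dF \<eta>\<close> hold.\<close>
  define c where "c = (dF \<eta> - l \<eta> \<Gamma> - s * l \<eta> z) / F \<eta>"
  define X where "X = \<Gamma> + s *\<^sub>R z + c *\<^sub>R \<eta>"
  have s: "s > 0" unfolding s_def using sqrt_pos[OF nz] .
  have Fnz: "F \<eta> \<noteq> 0" using F_pos[OF nz] by simp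
  have Dg: "((\<lambda>q. g q \<eta> w) has_derivative dg w) (at p)" for w
    unfolding dg_def by (rule has_derivative_dir_deriv[OF diff_g[OF p]])
  have D\<omega>: "((\<lambda>q. \<omega> q w) has_derivative d\<omega> w) (at p)" for w
    unfolding d\<omega>_def by (rule has_derivative_dir_deriv[OF diff_\<omega>[OF p]])
  have Ds: "((\<lambda>q. sqrt (g q \<eta> \<eta>)) has_derivative (\<lambda>a. dg \<eta> a / (2 * s))) (at p)"
    using has_derivative_real_sqrt[OF pos[OF nz] Dg[of \<eta>]] by (simp add: s_def field_simps)
  have DF: "((\<lambda>q. randers_fn (g q) (\<omega> q) \<eta>) has_derivative dF) (at p)"
    unfolding randers_fn_def dF_def by (intro has_derivative_add Ds D\<omega>)
  have Dl: "((\<lambda>q. randers_diff (g q) (\<omega> q) \<eta> w) has_derivative dl w) (at p)" for w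
    unfolding randers_diff_def dl_def s_def
    by (intro has_derivative_add has_derivative_divide' Ds[unfolded s_def] D\<omega> Dg)
      (use s s_def in simp)
  have D1: "dir_deriv (\<lambda>q. randers_fn (g q) (\<omega> q) \<eta> * randers_diff (g q) (\<omega> q) \<eta> w) p a
      = F \<eta> * dl w a + dF a * l \<eta> w" for w a
    by (rule dir_deriv_eq[OF has_derivative_mult[OF DF Dl]])
  have D2: "dir_deriv (\<lambda>q. (randers_fn (g q) (\<omega> q) \<eta>)\<^sup>2) p a / 2 = F \<eta> * dF a" for a
    using dir_deriv_eq[OF has_derivative_power[OF DF, of 2], of a] by simp
  have \<Gamma>: "g p \<Gamma> w = dg w \<eta> - dg \<eta> w / 2" for w
    unfolding \<Gamma>_def christoffel_works[OF p] dg_def by simp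
  have z: "g p z w = d\<omega> w \<eta> - d\<omega> \<eta> w" for w
    unfolding z_def riesz_works[OF linear_ext_deriv_coord[OF p]] by (simp add: ext_deriv_coord_def d\<omega>_def)
  have lX: "l \<eta> X = dF \<eta>"
    using Fnz by (simp add: X_def linear_add[OF l_linear] linear_cmul[OF l_linear] l_self nz c_def)
  have mX: "m \<eta> X w = dl w \<eta> - dF w" for w
  proof -
    have "m \<eta> X w = m \<eta> w \<Gamma> + s * m \<eta> w z"
      by (simp add: X_def m_sym[of \<eta> _ w] linear_add[OF m_linear] linear_cmul[OF m_linear] m_self nz)
    also have "\<dots> = ((dg w \<eta> - dg \<eta> w / 2) / s - g p \<eta> w * (dg \<eta> \<eta> - dg \<eta> \<eta> / 2) / s ^ 3)
        + s * ((d\<omega> w \<eta> - d\<omega> \<eta> w) / s - g p \<eta> w * (d\<omega> \<eta> \<eta> - d\<omega> \<eta> \<eta>) / s ^ 3)"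
      unfolding angular_def s_def[symmetric] sym[of w \<Gamma>] sym[of w z] sym[of \<eta> \<Gamma>] sym[of \<eta> z] \<Gamma> z ..
    also have "\<dots> = dl w \<eta> - dF w"
      using s unfolding dl_def dF_def by (simp add: field_simps power3_eq_cube)
    finally show ?thesis .
  qed
  have "riesz (fundamental_tensor \<Phi> \<eta> p) (\<lambda>w.
      dir_deriv (\<lambda>q. randers_fn (g q) (\<omega> q) \<eta> * randers_diff (g q) (\<omega> q) \<eta> w) p \<eta>
      - dir_deriv (\<lambda>q. (randers_fn (g q) (\<omega> q) \<eta>)\<^sup>2) p w / 2) = X" (is "riesz _ ?f = X")
  proof -
    have "fundamental_tensor \<Phi> \<eta> p X w = ?f w" for w
      unfolding fundamental_tensor_randers[where \<Phi> = \<Phi>, OF nz \<Phi>[OF p]] D1 D2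
      by (simp add: lX mX algebra_simps)
    then show ?thesis
      unfolding riesz_def
      by (intro the_equality allI fundamental_tensor_unique[where \<Phi> = \<Phi>, OF nz \<Phi>[OF p]]) simp_all
  qed
  with chern_coeff_form[where \<Phi> = \<Phi>, OF \<Phi> p nz] have "chern_coeff \<Phi> \<eta> p \<eta> \<eta> = X" by (rule trans)
  then show ?thesis
    unfolding X_def s_def z_def \<Gamma>_def by blast
qed

text \<open>For \<open>\<eta>\<close> tangent to a level set of \<open>f\<close> the multiple of \<open>\<eta>\<close> is invisible to \<open>df\<close>, and
  \<open>df z = g(grad f, z) = d\<omega>(\<eta>, grad f)\<close>.\<close>
lemma hessian_chern_randers:
  assumes \<Phi>: "\<And>q. q \<in> U \<Longrightarrow> \<Phi> q = randers_fn (g q) (\<omega> q)" and p: "p \<in> U" and nz: "\<eta> \<noteq> 0"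
    and f: "f differentiable (at p)" "dir_deriv f p \<eta> = 0"
  shows "hessian_coord (chern_coeff \<Phi> \<eta> p) f p \<eta> \<eta> = hessian_coord (christoffel g p) f p \<eta> \<eta>
    - sqrt (g p \<eta> \<eta>) * ext_deriv_coord \<omega> p \<eta> (riesz (g p) (dir_deriv f p))"
proof -
  interpret scalar_product "g p" by (rule scalar_product[OF p])
  note lin = linear_dir_deriv[OF f(1)]
  let ?z = "riesz (g p) (ext_deriv_coord \<omega> p \<eta>)"
  obtain c where c: "chern_coeff \<Phi> \<eta> p \<eta> \<eta> = christoffel g p \<eta> \<eta> + sqrt (g p \<eta> \<eta>) *\<^sub>R ?z + c *\<^sub>R \<eta>"
    using chern_coeff_randers[where \<Phi> = \<Phi>, OF \<Phi> p nz] by blast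
  have "dir_deriv f p ?z = g p (riesz (g p) (dir_deriv f p)) ?z"
    by (simp add: riesz_works lin)
  also have "\<dots> = g p ?z (riesz (g p) (dir_deriv f p))" by (rule sym)
  also have "\<dots> = ext_deriv_coord \<omega> p \<eta> (riesz (g p) (dir_deriv f p))"
    by (simp add: riesz_works linear_ext_deriv_coord p)
  finally show ?thesis
    by (simp add: hessian_coord_def c linear_add[OF lin] linear_cmul[OF lin] f(2))
qed

lemma christoffel_scale:
  assumes p: "p \<in> U"
  shows "christoffel g p (k *\<^sub>R a) (k *\<^sub>R a) = k\<^sup>2 *\<^sub>R christoffel g p a a"
proof -
  interpret scalar_product "g p" by (rule scalar_product[OF p])
  have r: "linear (\<lambda>w. dir_deriv (\<lambda>p. g p b w) p c)" for b c
    by (intro linear_dir_deriv_param[OF open_U] scalar_product.linear_right[OF scalar_product] diff_g p)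
  have l: "linear (\<lambda>b. dir_deriv (\<lambda>p. g p b w) p c)" for w c
    by (intro linear_dir_deriv_param[OF open_U] scalar_product.linear_left[OF scalar_product] diff_g p)
  have d: "linear (dir_deriv (\<lambda>p. g p b w) p)" for b w
    by (intro linear_dir_deriv diff_g p)
  show ?thesis
    by (rule unique_repr)
      (simp add: christoffel_works p linear_cmul[OF r] linear_cmul[OF l] linear_cmul[OF d]
        power2_eq_square algebra_simps)
qed

lemma hessian_scale:
  assumes p: "p \<in> U" and f: "\<And>q. q \<in> U \<Longrightarrow> f differentiable (at q)"
    and df: "\<And>a. (\<lambda>q. dir_deriv f q a) differentiable (at p)"
  shows "hessian_coord (christoffel g p) f p (k *\<^sub>R a) (k *\<^sub>R a)
    = k\<^sup>2 * hessian_coord (christoffel g p) f p a a"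
proof -
  have l: "linear (\<lambda>b. dir_deriv (\<lambda>q. dir_deriv f q b) p c)" for c
    by (intro linear_dir_deriv_param[OF open_U p] linear_dir_deriv f df)
  show ?thesis
    by (simp add: hessian_coord_def christoffel_scale p linear_cmul[OF l]
        linear_cmul[OF linear_dir_deriv[OF f[OF p]]] linear_cmul[OF linear_dir_deriv[OF df]]
        power2_eq_square algebra_simps)
qed

lemma ext_deriv_coord_scale:
  assumes p: "p \<in> U"
  shows "ext_deriv_coord \<omega> p (k *\<^sub>R a) b = k * ext_deriv_coord \<omega> p a b"
proof -
  have "ext_deriv_coord \<omega> p c b = - ext_deriv_coord \<omega> p b c" for c
    by (simp add: ext_deriv_coord_def)
  then show ?thesis by (simp add: linear_cmul[OF linear_ext_deriv_coord[OF p]])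
qed

end

section \<open>The warped product with a line in coordinates\<close>

text \<open>The metric \<open>g + du\<^sup>2 / \<beta>\<close> on the product of a line with coordinate \<open>u\<close> and an open subset of a
  Euclidean space. The line is the first factor.\<close>
definition warped_metric ::
    "('n::euclidean_space \<Rightarrow> 'n \<Rightarrow> 'n \<Rightarrow> real) \<Rightarrow> ('n \<Rightarrow> real) \<Rightarrow>
      real \<times> 'n \<Rightarrow> real \<times> 'n \<Rightarrow> real \<times> 'n \<Rightarrow> real" where
  "warped_metric g \<beta> q a b = g (snd q) (snd a) (snd b) + fst a * fst b / \<beta> (snd q)"

text \<open>The pullback of a one-form along the projection of the product to its second factor.\<close>
definition pullback_form ::
    "('n::euclidean_space \<Rightarrow> 'n \<Rightarrow> real) \<Rightarrow> real \<times> 'n \<Rightarrow> real \<times> 'n \<Rightarrow> real" where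
  "pullback_form \<omega> q a = \<omega> (snd q) (snd a)"

text \<open>A local Randers metric together with a positive warping function \<open>\<beta>\<close>.\<close>
locale randers_product = randers_field U g \<omega>
  for U :: "'n::euclidean_space set" and g :: "'n \<Rightarrow> 'n \<Rightarrow> 'n \<Rightarrow> real" and \<omega> :: "'n \<Rightarrow> 'n \<Rightarrow> real" +
  fixes \<beta> :: "'n \<Rightarrow> real"
  assumes \<beta>_pos: "p \<in> U \<Longrightarrow> \<beta> p > 0"
    and diff_\<beta>: "p \<in> U \<Longrightarrow> \<beta> differentiable (at p)"
begin

lemma warped_norm:
  assumes q: "snd q \<in> U"
  shows "randers_norm (warped_metric g \<beta> q) (pullback_form \<omega> q)"
proof -
  interpret randers_norm "g (snd q)" "\<omega> (snd q)" by (rule norm[OF q])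
  note b = \<beta>_pos[OF q]
  have pos': "warped_metric g \<beta> q a a > 0" if "a \<noteq> 0" for a
  proof (cases "snd a = 0")
    case True
    with that have "fst a \<noteq> 0" by (auto simp: prod_eq_iff)
    then have "0 < fst a * fst a" by (metis not_real_square_gt_zero)
    then show ?thesis using b True by (simp add: warped_metric_def)
  next
    case False
    have "0 \<le> fst a * fst a / \<beta> (snd q)" using b by simp
    with pos[OF False] show ?thesis by (simp add: warped_metric_def)
  qed
  have bound': "\<bar>pullback_form \<omega> q a\<bar> < sqrt (warped_metric g \<beta> q a a)" if "a \<noteq> 0" for a
  proof (cases "snd a = 0")
    case True
    then show ?thesis using pos'[OF that] by (simp add: pullback_form_def)
  next
    case False
    have "\<bar>pullback_form \<omega> q a\<bar> < sqrt (g (snd q) (snd a) (snd a))"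
      using bound[OF False] by (simp add: pullback_form_def)
    also have "\<dots> \<le> sqrt (warped_metric g \<beta> q a a)" using b by (simp add: warped_metric_def)
    finally show ?thesis .
  qed
  have bilin': "bilinear (warped_metric g \<beta> q)"
    unfolding bilinear_def
    by (intro conjI allI linearI) (simp_all add: warped_metric_def algebra_simps add_divide_distrib)
  have sym': "warped_metric g \<beta> q a c = warped_metric g \<beta> q c a" for a c
    by (simp add: warped_metric_def sym[of "snd a" "snd c"] mult.commute)
  have lin': "linear (pullback_form \<omega> q)"
    by (rule linearI) (simp_all add: pullback_form_def)
  show ?thesis
    by (intro randers_norm.intro scalar_product.intro randers_norm_axioms.intro bilin' sym' pos' lin' bound')
qed

lemma has_derivative_warped:
  assumes q: "snd q \<in> U"
  shows "((\<lambda>q. warped_metric g \<beta> q a b) has_derivative (\<lambda>c. dir_deriv (\<lambda>p. g p (snd a) (snd b)) (snd q) (snd c)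
    - fst a * fst b * dir_deriv \<beta> (snd q) (snd c) / (\<beta> (snd q))\<^sup>2)) (at q)"
proof -
  have "((\<lambda>q. warped_metric g \<beta> q a b) has_derivative (\<lambda>c. dir_deriv (\<lambda>p. g p (snd a) (snd b)) (snd q) (snd c)
    + (0 * \<beta> (snd q) - fst a * fst b * dir_deriv \<beta> (snd q) (snd c)) / (\<beta> (snd q) * \<beta> (snd q)))) (at q)"
    unfolding warped_metric_def
    by (intro has_derivative_add has_derivative_compose_snd[where f = "\<lambda>p. g p (snd a) (snd b)"]
        diff_g has_derivative_divide' has_derivative_const has_derivative_compose_snd diff_\<beta> q)
      (use \<beta>_pos[OF q] in simp)
  then show ?thesis by (simp add: power2_eq_square)
qed

sublocale product: randers_field "UNIV \<times> U" "warped_metric g \<beta>" "pullback_form \<omega>"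
proof (rule randers_field.intro)
  fix p :: "real \<times> 'n" and a b
  show "open ((UNIV :: real set) \<times> U)" using open_U by (intro open_Times) auto
  assume "p \<in> UNIV \<times> U"
  then have p: "snd p \<in> U" by auto
  show "randers_norm (warped_metric g \<beta> p) (pullback_form \<omega> p)"
    by (rule warped_norm[OF p])
  show "(\<lambda>p. warped_metric g \<beta> p a b) differentiable (at p)"
    by (rule differentiableI[OF has_derivative_warped[OF p]])
  show "(\<lambda>p. pullback_form \<omega> p a) differentiable (at p)"
    unfolding pullback_form_def
    using has_derivative_compose_snd[where f = "\<lambda>p. \<omega> p (snd a)", OF diff_\<omega>[OF p]]
    by (rule differentiableI)
qed

text \<open>The component along the line is annihilated by the differential of functions that do not depend
  on \<open>u\<close>, so the component along the second factor is enough.\<close>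
lemma snd_christoffel_warped:
  assumes p: "p \<in> U"
  shows "snd (christoffel (warped_metric g \<beta>) (u, p) (v, y) (v, y)) =
    christoffel g p y y + (v\<^sup>2 / (2 * (\<beta> p)\<^sup>2)) *\<^sub>R riesz (g p) (dir_deriv \<beta> p)" (is "snd ?\<Gamma> = _")
proof -
  interpret scalar_product "g p" by (rule scalar_product[OF p])
  note D = dir_deriv_eq[OF has_derivative_warped]
  show ?thesis
  proof (rule unique_repr)
    fix w
    have "g p (snd ?\<Gamma>) w = warped_metric g \<beta> (u, p) ?\<Gamma> (0, w)"
      by (simp add: warped_metric_def)
    also have "\<dots> = dir_deriv (\<lambda>p. g p y w) p y - dir_deriv (\<lambda>p. g p y y) p w / 2
        + v\<^sup>2 / (2 * (\<beta> p)\<^sup>2) * dir_deriv \<beta> p w"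
      using p by (subst product.christoffel_works) (simp_all add: D power2_eq_square diff_divide_distrib)
    also have "\<dots> = g p (christoffel g p y y + (v\<^sup>2 / (2 * (\<beta> p)\<^sup>2)) *\<^sub>R riesz (g p) (dir_deriv \<beta> p)) w"
      by (simp add: christoffel_works p riesz_works linear_dir_deriv diff_\<beta>)
    finally show "g p (snd ?\<Gamma>) w = \<dots>" .
  qed
qed

lemma ext_deriv_coord_pullback:
  assumes p: "p \<in> U"
  shows "ext_deriv_coord (pullback_form \<omega>) (u, p) a b = ext_deriv_coord \<omega> p (snd a) (snd b)"
proof -
  have "dir_deriv (\<lambda>q :: real \<times> 'n. pullback_form \<omega> q b) (u, p) a = dir_deriv (\<lambda>p. \<omega> p (snd b)) p (snd a)" for a b
    unfolding pullback_form_def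
    by (subst dir_deriv_compose_snd[where f = "\<lambda>p. \<omega> p (snd b)"]) (simp_all add: diff_\<omega> p)
  then show ?thesis by (simp add: ext_deriv_coord_def)
qed

text \<open>Compared with the Hessian of the second factor, the warping contributes the term with
  \<open>g(grad f, grad \<beta>)\<close> and adds \<open>v\<^sup>2 / \<beta>\<close> to the squared length of the direction.\<close>
lemma hessian_chern_product:
  assumes \<Phi>: "\<And>q. q \<in> UNIV \<times> U \<Longrightarrow> \<Phi> q = randers_fn (warped_metric g \<beta> q) (pullback_form \<omega> q)"
    and p: "p \<in> U" and nz: "(v, y) \<noteq> 0"
    and f: "\<And>q. q \<in> U \<Longrightarrow> f differentiable (at q)"
    and df: "\<And>a. (\<lambda>q. dir_deriv f q a) differentiable (at p)"
    and tangent: "dir_deriv f p y = 0"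
  shows "hessian_coord (chern_coeff \<Phi> (v, y) (u, p)) (\<lambda>q. f (snd q)) (u, p) (v, y) (v, y) =
    hessian_coord (christoffel g p) f p y y
    - v\<^sup>2 / (2 * (\<beta> p)\<^sup>2) * g p (riesz (g p) (dir_deriv f p)) (riesz (g p) (dir_deriv \<beta> p))
    - sqrt (g p y y + v\<^sup>2 / \<beta> p) * ext_deriv_coord \<omega> p y (riesz (g p) (dir_deriv f p))"
proof -
  interpret P: scalar_product "warped_metric g \<beta> (u, p)"
    using p by (intro product.scalar_product) auto
  interpret scalar_product "g p" by (rule scalar_product[OF p])
  let ?f = "\<lambda>q :: real \<times> 'n. f (snd q)"
  let ?grad = "riesz (g p) (dir_deriv f p)"
  have d: "dir_deriv ?f q a = dir_deriv f (snd q) (snd a)" if "snd q \<in> U" for q a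
    by (rule dir_deriv_compose_snd[OF f[OF that]])
  have grad: "riesz (warped_metric g \<beta> (u, p)) (dir_deriv ?f (u, p)) = (0, ?grad)"
    by (rule P.riesz_eqI)
      (simp add: warped_metric_def d p riesz_works linear_dir_deriv f)
  have dd: "dir_deriv (\<lambda>q. dir_deriv ?f q (v, y)) (u, p) (v, y) = dir_deriv (\<lambda>p. dir_deriv f p y) p y"
  proof -
    have "dir_deriv (\<lambda>q. dir_deriv ?f q (v, y)) (u, p) = dir_deriv (\<lambda>q. dir_deriv f (snd q) y) (u, p)"
      using p by (intro dir_deriv_cong[OF product.open_U]) (auto simp: d)
    then show ?thesis
      using dir_deriv_compose_snd[where f = "\<lambda>p. dir_deriv f p y" and q = "(u, p)"] df by simp
  qed
  have df_riesz: "dir_deriv f p z = g p ?grad z" for z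
    by (simp add: riesz_works linear_dir_deriv f p)
  have "hessian_coord (chern_coeff \<Phi> (v, y) (u, p)) ?f (u, p) (v, y) (v, y) =
      hessian_coord (christoffel (warped_metric g \<beta>) (u, p)) ?f (u, p) (v, y) (v, y)
      - sqrt (warped_metric g \<beta> (u, p) (v, y) (v, y)) *
        ext_deriv_coord (pullback_form \<omega>) (u, p) (v, y) (riesz (warped_metric g \<beta> (u, p)) (dir_deriv ?f (u, p)))"
  proof (rule product.hessian_chern_randers[where \<Phi> = \<Phi>, OF \<Phi> _ nz])
    show "?f differentiable at (u, p)"
      using has_derivative_compose_snd[OF f, where q = "(u, p)"] p by (auto intro: differentiableI)
    show "dir_deriv ?f (u, p) (v, y) = 0" using p by (simp add: d tangent)
    show "(u, p) \<in> UNIV \<times> U" using p by simp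
  qed
  also have "hessian_coord (christoffel (warped_metric g \<beta>) (u, p)) ?f (u, p) (v, y) (v, y) =
      hessian_coord (christoffel g p) f p y y
      - v\<^sup>2 / (2 * (\<beta> p)\<^sup>2) * g p ?grad (riesz (g p) (dir_deriv \<beta> p))"
  proof -
    have "dir_deriv ?f (u, p) (christoffel (warped_metric g \<beta>) (u, p) (v, y) (v, y)) =
        dir_deriv f p (christoffel g p y y) + v\<^sup>2 / (2 * (\<beta> p)\<^sup>2) * dir_deriv f p (riesz (g p) (dir_deriv \<beta> p))"
      using d[of "(u, p)"] linear_dir_deriv[OF f[OF p]] p
      by (simp add: snd_christoffel_warped linear_add linear_cmul)
    then show ?thesis by (simp add: hessian_coord_def dd flip: df_riesz)
  qed
  finally show ?thesis
    by (simp add: grad ext_deriv_coord_pullback p) (simp add: warped_metric_def power2_eq_square)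
qed

end

section \<open>Tangent vectors and local representatives\<close>

lemma Cinf_on_differentiable:
  "Cinf_on f U \<Longrightarrow> p \<in> U \<Longrightarrow> f differentiable (at p)"
proof -
  assume "Cinf_on f U" "p \<in> U"
  then have "C_on (Suc 0) f U" unfolding Cinf_on_def by blast
  then show ?thesis using \<open>p \<in> U\<close> by simp
qed

lemma riemannian_metricD:
  assumes "riemannian_metric A h"
  shows "y \<in> tangent_space A x \<Longrightarrow> z \<in> tangent_space A x \<Longrightarrow> h x y z = h x z y"
    and "y \<in> tangent_space A x \<Longrightarrow> y \<noteq> (\<lambda>_. 0) \<Longrightarrow> h x y y > 0"
    and "i \<in> chart_index A \<Longrightarrow> p \<in> chart_map A i ` chart_dom A i \<Longrightarrow> bilinear (loc2 A h i p)"
    and "i \<in> chart_index A \<Longrightarrow> Cinf_on (\<lambda>p. loc2 A h i p a b) (chart_map A i ` chart_dom A i)"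
  using assms unfolding riemannian_metric_def by auto

lemma one_formD:
  assumes "one_form A \<omega>"
  shows "i \<in> chart_index A \<Longrightarrow> p \<in> chart_map A i ` chart_dom A i \<Longrightarrow> linear (loc1 A \<omega> i p)"
    and "i \<in> chart_index A \<Longrightarrow> Cinf_on (\<lambda>p. loc1 A \<omega> i p a) (chart_map A i ` chart_dom A i)"
  using assms unfolding one_form_def by auto

text \<open>In a chart \<open>i\<close> with domain \<open>V i\<close>, the chart map is \<open>\<kappa> i\<close>, its image \<open>im i\<close> and its inverse \<open>\<psi> i\<close>.\<close>
locale manifold =
  fixes A :: "('i, 'a::{t2_space,second_countable_topology}, 'n::euclidean_space) atlas"
  assumes smooth: "smooth_manifold A"
begin

abbreviation "V \<equiv> chart_dom A"
abbreviation "\<kappa> \<equiv> chart_map A"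
abbreviation "\<psi> \<equiv> chart_inv A"
abbreviation "im i \<equiv> \<kappa> i ` V i"

text \<open>The derivative at \<open>x\<close> of the change of coordinates from the chart \<open>i\<close> to the chart \<open>j\<close>.\<close>
definition jac :: "'i \<Rightarrow> 'i \<Rightarrow> 'a \<Rightarrow> 'n \<Rightarrow> 'n" where
  "jac i j x = dir_deriv (\<kappa> j \<circ> \<psi> i) (\<kappa> i x)"

lemma chart:
  assumes "i \<in> chart_index A"
  shows "open (V i)" "open (im i)" "homeomorphism (V i) (im i) (\<kappa> i) (\<psi> i)"
  using assms smooth unfolding smooth_manifold_def open_embedding_on_def chart_inv_def by auto

lemma \<psi>_\<kappa>: "i \<in> chart_index A \<Longrightarrow> x \<in> V i \<Longrightarrow> \<psi> i (\<kappa> i x) = x"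
  using chart(3)[of i] by (simp add: homeomorphism_def)

lemma \<kappa>_\<psi>: "i \<in> chart_index A \<Longrightarrow> p \<in> im i \<Longrightarrow> \<kappa> i (\<psi> i p) = p"
  using chart(3)[of i] by (auto simp: homeomorphism_def)

lemma \<psi>_in_V: "i \<in> chart_index A \<Longrightarrow> p \<in> im i \<Longrightarrow> \<psi> i p \<in> V i"
  using chart(3)[of i] unfolding homeomorphism_def by blast

lemma charts_atD: "i \<in> charts_at A x \<Longrightarrow> i \<in> chart_index A" "i \<in> charts_at A x \<Longrightarrow> x \<in> V i"
  by (simp_all add: charts_at_def)

lemma charts_at_\<psi>: "i \<in> chart_index A \<Longrightarrow> p \<in> im i \<Longrightarrow> i \<in> charts_at A (\<psi> i p)"
  using \<psi>_in_V by (simp add: charts_at_def)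

lemma chart_at_in: "chart_at A x \<in> charts_at A x"
proof -
  have "x \<in> (\<Union>i\<in>chart_index A. V i)"
    using smooth unfolding smooth_manifold_def by simp
  then have "\<exists>i. i \<in> charts_at A x" by (auto simp: charts_at_def)
  then show ?thesis unfolding chart_at_def by (rule someI_ex)
qed

lemma open_overlap:
  assumes "i \<in> chart_index A" "j \<in> chart_index A"
  shows "open (\<kappa> i ` (V i \<inter> V j))"
proof -
  have "\<kappa> i ` (V i \<inter> V j) = im i \<inter> \<psi> i -` V j"
    using \<psi>_\<kappa>[OF assms(1)] \<kappa>_\<psi>[OF assms(1)] \<psi>_in_V[OF assms(1)] by force
  moreover have "continuous_on (im i) (\<psi> i)"
    using chart(3)[OF assms(1)] by (simp add: homeomorphism_def)
  ultimately show ?thesis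
    using chart(1)[OF assms(2)] chart(2)[OF assms(1)] by (simp add: continuous_open_preimage)
qed

lemma has_derivative_transition:
  assumes "i \<in> charts_at A x" "j \<in> charts_at A x"
  shows "((\<kappa> j \<circ> \<psi> i) has_derivative jac i j x) (at (\<kappa> i x))"
proof -
  have "Cinf_on (\<kappa> j \<circ> \<psi> i) (\<kappa> i ` (V i \<inter> V j))"
    using smooth assms unfolding smooth_manifold_def transition_def chart_inv_def charts_at_def by auto
  then have "(\<kappa> j \<circ> \<psi> i) differentiable (at (\<kappa> i x))"
    by (rule Cinf_on_differentiable) (use assms in \<open>auto simp: charts_at_def\<close>)
  then show ?thesis unfolding jac_def by (rule has_derivative_dir_deriv)
qed

lemma jac_chain:
  assumes "i \<in> charts_at A x" "j \<in> charts_at A x" "k \<in> charts_at A x"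
  shows "jac j k x (jac i j x a) = jac i k x a"
proof -
  note c = charts_atD[OF assms(1)] charts_atD[OF assms(2)] charts_atD[OF assms(3)]
  have *: "\<kappa> j (\<psi> i (\<kappa> i x)) = \<kappa> j x" using c by (simp add: \<psi>_\<kappa>)
  have "((\<kappa> k \<circ> \<psi> j) \<circ> (\<kappa> j \<circ> \<psi> i) has_derivative jac j k x \<circ> jac i j x) (at (\<kappa> i x))"
    by (rule diff_chain_at) (use has_derivative_transition assms * in \<open>auto simp: o_def\<close>)
  moreover have "dir_deriv ((\<kappa> k \<circ> \<psi> j) \<circ> (\<kappa> j \<circ> \<psi> i)) (\<kappa> i x) = dir_deriv (\<kappa> k \<circ> \<psi> i) (\<kappa> i x)"
    using c by (intro dir_deriv_cong[OF open_overlap[of i j]]) (auto simp: \<psi>_\<kappa>)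
  ultimately show ?thesis by (metis jac_def comp_apply frechet_derivative_at)
qed

lemma jac_self:
  assumes "i \<in> charts_at A x"
  shows "jac i i x a = a"
proof -
  note c = charts_atD[OF assms(1)]
  have "jac i i x = dir_deriv (\<lambda>p. p) (\<kappa> i x)"
    unfolding jac_def using c by (intro dir_deriv_cong[OF chart(2)]) (auto simp: \<kappa>_\<psi>)
  then show ?thesis using dir_deriv_eq[OF has_derivative_ident] by simp
qed

lemma linear_jac: "i \<in> charts_at A x \<Longrightarrow> j \<in> charts_at A x \<Longrightarrow> linear (jac i j x)"
  using has_derivative_transition by (blast intro: has_derivative_linear)

lemma tvec_eq: "tvec A i x a = (\<lambda>j. if j \<in> charts_at A x then jac i j x a else 0)"
  unfolding tvec_def jac_def ..

lemma tangentI: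
  assumes "\<And>i. i \<notin> charts_at A x \<Longrightarrow> y i = 0"
    and "\<And>i j. i \<in> charts_at A x \<Longrightarrow> j \<in> charts_at A x \<Longrightarrow> y j = jac i j x (y i)"
  shows "y \<in> tangent_space A x"
  using assms unfolding tangent_space_def jac_def by blast

lemma tangentD:
  assumes "y \<in> tangent_space A x"
  shows "i \<notin> charts_at A x \<Longrightarrow> y i = 0"
    and "i \<in> charts_at A x \<Longrightarrow> j \<in> charts_at A x \<Longrightarrow> jac i j x (y i) = y j"
proof -
  have *: "(\<forall>i. i \<notin> charts_at A x \<longrightarrow> y i = 0) \<and>
      (\<forall>i\<in>charts_at A x. \<forall>j\<in>charts_at A x. y j = jac i j x (y i))"
    using assms unfolding tangent_space_def jac_def by blast
  then show "i \<notin> charts_at A x \<Longrightarrow> y i = 0" by blast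
  show "jac i j x (y i) = y j" if "i \<in> charts_at A x" "j \<in> charts_at A x"
    using * that by (intro HOL.sym[of "y j"]) blast
qed

lemma tvec_tangent: "i \<in> charts_at A x \<Longrightarrow> tvec A i x a \<in> tangent_space A x"
  by (rule tangentI) (simp_all add: tvec_eq jac_chain)

lemma tvec_comp [simp]: "i \<in> charts_at A x \<Longrightarrow> tvec A i x a i = a"
  by (simp add: tvec_eq jac_self)

lemma tvec_of_tangent: "i \<in> charts_at A x \<Longrightarrow> y \<in> tangent_space A x \<Longrightarrow> tvec A i x (y i) = y"
  by (rule ext) (simp add: tvec_eq tangentD)

lemma tangent_eqI:
  "i \<in> charts_at A x \<Longrightarrow> y \<in> tangent_space A x \<Longrightarrow> z \<in> tangent_space A x \<Longrightarrow> y i = z i \<Longrightarrow> y = z"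
  using tvec_of_tangent by metis

lemma tangent_scale:
  "y \<in> tangent_space A x \<Longrightarrow> (\<lambda>j. c *\<^sub>R y j) \<in> tangent_space A x"
  by (rule tangentI) (simp_all add: linear_cmul[OF linear_jac] tangentD)

lemma zero_tangent: "(\<lambda>_. 0) \<in> tangent_space A x"
  by (rule tangentI) (simp_all add: linear_0[OF linear_jac])

lemma tangent_nonzero:
  "i \<in> charts_at A x \<Longrightarrow> y \<in> tangent_space A x \<Longrightarrow> y \<noteq> (\<lambda>_. 0) \<longleftrightarrow> y i \<noteq> 0"
  using tangent_eqI[of i x y "\<lambda>_. 0"] zero_tangent[of x] by auto

lemma loc1_at: "i \<in> charts_at A x \<Longrightarrow> y \<in> tangent_space A x \<Longrightarrow> loc1 A F i (\<kappa> i x) (y i) = F x y"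
  by (simp add: loc1_def \<psi>_\<kappa> charts_atD tvec_of_tangent)

lemma loc2_at: "i \<in> charts_at A x \<Longrightarrow> y \<in> tangent_space A x \<Longrightarrow> z \<in> tangent_space A x \<Longrightarrow>
    loc2 A h i (\<kappa> i x) (y i) (z i) = h x y z"
  by (simp add: loc2_def \<psi>_\<kappa> charts_atD tvec_of_tangent)

lemma tangent_to_scale:
  assumes "y \<in> tangent_to A N x"
  shows "(\<lambda>j. c *\<^sub>R y j) \<in> tangent_to A N x"
proof -
  obtain \<gamma> :: "real \<Rightarrow> 'a" where y: "y \<in> tangent_space A x" and \<gamma>: "\<gamma> 0 = x" "isCont \<gamma> 0" "range \<gamma> \<subseteq> N"
    and d: "\<And>i. i \<in> charts_at A x \<Longrightarrow> ((\<kappa> i \<circ> \<gamma>) has_vector_derivative y i) (at 0)"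
    using assms unfolding tangent_to_def by blast
  let ?\<gamma> = "\<lambda>t. \<gamma> (c * t)"
  have "isCont ?\<gamma> 0"
    by (rule isCont_o2[where f = "\<lambda>t. c * t"]) (simp_all add: \<gamma>(2))
  moreover have "((\<kappa> i \<circ> ?\<gamma>) has_vector_derivative c *\<^sub>R y i) (at 0)" if "i \<in> charts_at A x" for i
  proof -
    have "((\<kappa> i \<circ> \<gamma>) \<circ> (\<lambda>t. c * t) has_vector_derivative c *\<^sub>R y i) (at 0)"
      by (rule vector_diff_chain_at)
        (use d[OF that] in \<open>auto simp: has_vector_derivative_def intro!: derivative_eq_intros\<close>)
    then show ?thesis by (simp add: o_def)
  qed
  moreover have "range ?\<gamma> \<subseteq> N" "?\<gamma> 0 = x" using \<gamma> by auto
  ultimately show ?thesis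
    using tangent_scale[OF y] unfolding tangent_to_def mem_Collect_eq
    by (intro conjI exI[of _ ?\<gamma>] ballI)
qed

lemma zero_tangent_to: "x \<in> N \<Longrightarrow> (\<lambda>_. 0) \<in> tangent_to A N x"
  unfolding tangent_to_def mem_Collect_eq
  by (intro conjI exI[of _ "\<lambda>_. x"] zero_tangent ballI) (auto simp: o_def)

text \<open>Vectors tangent to \<open>N\<close> are in the kernel of the differential of any function that vanishes on \<open>N\<close>.\<close>
lemma tangent_to_kernel:
  assumes y: "y \<in> tangent_to A N x" and f: "\<And>z. z \<in> N \<Longrightarrow> f z = (0::real)"
    and i: "i \<in> charts_at A x" and diff: "(f \<circ> \<psi> i) differentiable (at (\<kappa> i x))"
  shows "dir_deriv (f \<circ> \<psi> i) (\<kappa> i x) (y i) = 0"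
proof -
  obtain \<gamma> :: "real \<Rightarrow> 'a" where \<gamma>: "\<gamma> 0 = x" "isCont \<gamma> 0" "range \<gamma> \<subseteq> N"
    and d: "((\<kappa> i \<circ> \<gamma>) has_vector_derivative y i) (at 0)"
    using y i unfolding tangent_to_def by blast
  have "((f \<circ> \<psi> i) \<circ> (\<kappa> i \<circ> \<gamma>) has_derivative
      dir_deriv (f \<circ> \<psi> i) (\<kappa> i x) \<circ> (\<lambda>t. t *\<^sub>R y i)) (at 0)"
    by (rule diff_chain_at)
      (use d has_derivative_dir_deriv[OF diff] in \<open>simp_all add: has_vector_derivative_def \<gamma>(1)\<close>)
  moreover have "((f \<circ> \<psi> i) \<circ> (\<kappa> i \<circ> \<gamma>) has_derivative (\<lambda>_. 0)) (at 0)"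
  proof -
    have "\<forall>\<^sub>F t in at 0. \<gamma> t \<in> V i"
      using \<gamma>(2) chart(1)[OF charts_atD(1)[OF i]] charts_atD(2)[OF i] unfolding isCont_def \<gamma>(1)
      by (rule topological_tendstoD)
    then have "\<forall>\<^sub>F t in at 0. 0 = ((f \<circ> \<psi> i) \<circ> (\<kappa> i \<circ> \<gamma>)) t"
      by eventually_elim (use \<gamma>(3) in \<open>auto simp: \<psi>_\<kappa> charts_atD(1)[OF i] f subset_iff\<close>)
    moreover have "0 = ((f \<circ> \<psi> i) \<circ> (\<kappa> i \<circ> \<gamma>)) 0"
      using \<gamma>(1,3) by (auto simp: \<psi>_\<kappa> charts_atD[OF i] f subset_iff)
    ultimately show ?thesis
      by (intro has_derivative_transform_eventually[OF has_derivative_const]) auto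
  qed
  ultimately have "dir_deriv (f \<circ> \<psi> i) (\<kappa> i x) \<circ> (\<lambda>t. t *\<^sub>R y i) = (\<lambda>_. 0)"
    by (rule has_derivative_unique)
  from fun_cong[OF this, of 1] show ?thesis by simp
qed

lemma scalar_product_loc2:
  assumes h: "riemannian_metric A h" and i: "i \<in> chart_index A" and p: "p \<in> im i"
  shows "scalar_product (loc2 A h i p)"
proof (rule scalar_product.intro)
  let ?x = "\<psi> i p"
  note c = charts_at_\<psi>[OF i p]
  show "bilinear (loc2 A h i p)" by (rule riemannian_metricD(3)[OF h i p])
  fix a b
  show "loc2 A h i p a b = loc2 A h i p b a"
    unfolding loc2_def by (rule riemannian_metricD(1)[OF h tvec_tangent[OF c] tvec_tangent[OF c]])
  assume "a \<noteq> 0"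
  then have "tvec A i ?x a \<noteq> (\<lambda>_. 0)" using tvec_comp[OF c, of a] by metis
  then show "0 < loc2 A h i p a a"
    unfolding loc2_def by (rule riemannian_metricD(2)[OF h tvec_tangent[OF c]])
qed

text \<open>The supremum in \<^const>\<open>form_norm\<close> is a supremum of real numbers, so it is an upper bound only
  because the quotients are bounded: by the Cauchy-Schwarz inequality, the length of the vector
  that represents \<open>\<omega>\<close> is a bound.\<close>
lemma form_norm_bound:
  assumes h: "riemannian_metric A h" and \<omega>: "one_form A \<omega>"
    and y: "y \<in> tangent_space A x" "y \<noteq> (\<lambda>_. 0)"
  shows "\<bar>\<omega> x y\<bar> / sqrt (h x y y) \<le> form_norm A h \<omega> x"
proof -
  define i where "i = chart_at A x"
  have i: "i \<in> charts_at A x" unfolding i_def by (rule chart_at_in)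
  let ?g = "loc2 A h i (\<kappa> i x)" and ?\<omega> = "loc1 A \<omega> i (\<kappa> i x)"
  have p: "\<kappa> i x \<in> im i" using charts_atD[OF i] by simp
  interpret scalar_product ?g by (rule scalar_product_loc2[OF h charts_atD(1)[OF i] p])
  have "linear ?\<omega>" by (rule one_formD(1)[OF \<omega> charts_atD(1)[OF i] p])
  then obtain z where z: "\<And>w. ?g z w = ?\<omega> w" using repr_exists by blast
  have "\<bar>\<omega> x w\<bar> / sqrt (h x w w) \<le> sqrt (?g z z)" if w: "w \<in> tangent_space A x - {\<lambda>_. 0}" for w
  proof -
    have "w i \<noteq> 0" using w tangent_nonzero[OF i, of w] by simp
    then have pos_w: "sqrt (h x w w) > 0" using pos[of "w i"] w loc2_at[OF i, of w w] by simp
    have "(\<omega> x w)\<^sup>2 \<le> ?g z z * h x w w"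
      using cauchy_schwarz[of z "w i"] w loc2_at[OF i, of w w] loc1_at[OF i, of w] z by simp
    then have "sqrt ((\<omega> x w)\<^sup>2) \<le> sqrt (?g z z * h x w w)" by (rule real_sqrt_le_mono)
    then have "\<bar>\<omega> x w\<bar> \<le> sqrt (?g z z) * sqrt (h x w w)" by (simp add: real_sqrt_mult)
    then show ?thesis using pos_w by (simp add: field_simps)
  qed
  then have "bdd_above ((\<lambda>w. \<bar>\<omega> x w\<bar> / sqrt (h x w w)) ` (tangent_space A x - {\<lambda>_. 0}))"
    by (intro bdd_aboveI2)
  from cSUP_upper[OF _ this, of y] show ?thesis using y unfolding form_norm_def by blast
qed

lemma randers_field_loc:
  assumes "randers_space A h \<omega>" and i: "i \<in> chart_index A"
  shows "randers_field (im i) (loc2 A h i) (loc1 A \<omega> i)"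
proof (rule randers_field.intro)
  have h: "riemannian_metric A h" and \<omega>: "one_form A \<omega>" and n: "\<forall>x. form_norm A h \<omega> x < 1"
    using assms(1) unfolding randers_space_def by simp_all
  show "open (im i)" by (rule chart(2)[OF i])
  fix p a b assume p: "p \<in> im i"
  show "(\<lambda>p. loc2 A h i p a b) differentiable (at p)"
    by (rule Cinf_on_differentiable[OF riemannian_metricD(4)[OF h i] p])
  show "(\<lambda>p. loc1 A \<omega> i p a) differentiable (at p)"
    by (rule Cinf_on_differentiable[OF one_formD(2)[OF \<omega> i] p])
  interpret scalar_product "loc2 A h i p" by (rule scalar_product_loc2[OF h i p])
  show "randers_norm (loc2 A h i p) (loc1 A \<omega> i p)"
  proof (intro randers_norm.intro randers_norm_axioms.intro scalar_product_loc2[OF h i p])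
    show "linear (loc1 A \<omega> i p)" by (rule one_formD(1)[OF \<omega> i p])
    fix a :: 'n assume "a \<noteq> 0"
    let ?x = "\<psi> i p"
    let ?y = "tvec A i ?x a"
    note c = charts_at_\<psi>[OF i p]
    have y: "?y \<in> tangent_space A ?x" "?y \<noteq> (\<lambda>_. 0)"
      using tvec_tangent[OF c] tvec_comp[OF c, of a] \<open>a \<noteq> 0\<close> by metis+
    have "\<bar>\<omega> ?x ?y\<bar> / sqrt (h ?x ?y ?y) < 1"
      using form_norm_bound[OF h \<omega> y] n[rule_format] by (rule le_less_trans)
    moreover have "sqrt (h ?x ?y ?y) > 0" using pos[OF \<open>a \<noteq> 0\<close>] by (simp add: loc2_def)
    ultimately show "\<bar>loc1 A \<omega> i p a\<bar> < sqrt (loc2 A h i p a a)"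
      by (simp add: loc1_def loc2_def field_simps)
  qed
qed

lemma gradient_eq:
  assumes h: "riemannian_metric A h" and diff: "(f \<circ> \<psi> (chart_at A x)) differentiable (at (\<kappa> (chart_at A x) x))"
  defines "i \<equiv> chart_at A x"
  shows "gradient A h f x \<in> tangent_space A x"
    and "gradient A h f x i = riesz (loc2 A h i (\<kappa> i x)) (dir_deriv (f \<circ> \<psi> i) (\<kappa> i x))"
proof -
  have i: "i \<in> charts_at A x" unfolding i_def by (rule chart_at_in)
  let ?g = "loc2 A h i (\<kappa> i x)" and ?df = "dir_deriv (f \<circ> \<psi> i) (\<kappa> i x)"
  have p: "\<kappa> i x \<in> im i" using charts_atD[OF i] by simp
  interpret scalar_product ?g by (rule scalar_product_loc2[OF h charts_atD(1)[OF i] p])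
  have lin: "linear ?df" using linear_dir_deriv[OF diff] unfolding i_def .
  let ?z = "tvec A i x (riesz ?g ?df)"
  have z: "?z \<in> tangent_space A x" by (rule tvec_tangent[OF i])
  have d: "differential A f x w = ?df (w i)" for w
    unfolding differential_def i_def Let_def ..
  have "gradient A h f x = ?z"
    unfolding gradient_def
  proof (rule the_equality)
    have "h x ?z w = differential A f x w" if "w \<in> tangent_space A x" for w
      using loc2_at[OF i z that, of h] riesz_works[OF lin, of "w i"] i by (simp add: d)
    with z show "?z \<in> tangent_space A x \<and> (\<forall>w\<in>tangent_space A x. h x ?z w = differential A f x w)"
      by blast
    fix z' assume z': "z' \<in> tangent_space A x \<and> (\<forall>w\<in>tangent_space A x. h x z' w = differential A f x w)"
    have "?g (z' i) a = ?df a" for a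
      using z' loc2_at[OF i, of z' "tvec A i x a" h] tvec_tangent[OF i, of a] i by (simp add: d)
    then have "riesz ?g ?df = z' i" by (rule riesz_eqI)
    then show "z' = ?z" using z' i by (intro tangent_eqI[OF i _ z]) auto
  qed
  with z i show "gradient A h f x \<in> tangent_space A x" "gradient A h f x i = riesz ?g ?df" by simp_all
qed

end

section \<open>The product of a manifold with a line\<close>

context manifold
begin

abbreviation "P \<equiv> product_atlas A"

lemma charts_at_product [simp]: "charts_at P (u, x) = charts_at A x"
  by (simp add: charts_at_def product_atlas_def)

lemma chart_at_product [simp]: "chart_at P (u, x) = chart_at A x"
  by (simp add: chart_at_def)

lemma chart_map_product [simp]: "chart_map P i (u, x) = (u, \<kappa> i x)"
  by (simp add: product_atlas_def)

lemma chart_inv_product: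
  assumes i: "i \<in> chart_index A" and p: "p \<in> im i"
  shows "chart_inv P i (u, p) = (u, \<psi> i p)"
proof -
  have "inj_on (\<kappa> i) (V i)" using \<psi>_\<kappa>[OF i] by (rule inj_on_inverseI)
  then have "inj_on (chart_map P i) (UNIV \<times> V i)"
    unfolding inj_on_def product_atlas_def by auto
  moreover have "chart_map P i (u, \<psi> i p) = (u, p)" using \<kappa>_\<psi>[OF i p] by simp
  moreover have "(u, \<psi> i p) \<in> UNIV \<times> V i" using \<psi>_in_V[OF i p] by simp
  ultimately have "the_inv_into (UNIV \<times> V i) (chart_map P i) (u, p) = (u, \<psi> i p)"
    by (intro the_inv_into_f_eq)
  then show ?thesis by (simp add: chart_inv_def product_atlas_def)
qed

lemma jac_product:
  assumes i: "i \<in> charts_at A x" and j: "j \<in> charts_at A x"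
  shows "dir_deriv (chart_map P j \<circ> chart_inv P i) (chart_map P i (u, x)) a = (fst a, jac i j x (snd a))"
proof -
  note c = charts_atD[OF i]
  let ?t = "\<lambda>q :: real \<times> 'n. (fst q, (\<kappa> j \<circ> \<psi> i) (snd q))"
  have "dir_deriv (chart_map P j \<circ> chart_inv P i) (chart_map P i (u, x)) = dir_deriv ?t (u, \<kappa> i x)"
    unfolding chart_map_product
    using c by (intro dir_deriv_cong[of "UNIV \<times> im i"] open_Times chart(2)) (auto simp: chart_inv_product \<psi>_\<kappa>)
  moreover have "(?t has_derivative (\<lambda>a. (fst a, jac i j x (snd a)))) (at (u, \<kappa> i x))"
    by (intro has_derivative_Pair has_derivative_fst[OF has_derivative_ident]
        has_derivative_compose[OF has_derivative_snd[OF has_derivative_ident]])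
      (use has_derivative_transition[OF i j] in \<open>simp add: o_def\<close>)
  ultimately show ?thesis by (simp add: dir_deriv_eq)
qed

lemma tvec_product:
  assumes i: "i \<in> charts_at A x"
  shows "tvec P i (u, x) a = (\<lambda>j. if j \<in> charts_at A x then (fst a, jac i j x (snd a)) else 0)"
  unfolding tvec_def charts_at_product by (rule ext) (simp only: jac_product[OF i] cong: if_cong)

lemma loc1_randers:
  "loc1 A (randers_metric h \<omega>) i p = randers_fn (loc2 A h i p) (loc1 A \<omega> i p)"
  by (rule ext) (simp add: loc1_def loc2_def randers_metric_def randers_fn_def)

lemma loc1_randers_beta:
  assumes i: "i \<in> chart_index A" and q: "q \<in> UNIV \<times> im i"
  shows "loc1 P (randers_beta A h \<omega> \<beta>) i q =
    randers_fn (warped_metric (loc2 A h i) (\<beta> \<circ> \<psi> i) q) (pullback_form (loc1 A \<omega> i) q)"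
proof
  fix a :: "real \<times> 'n"
  obtain u p where [simp]: "q = (u, p)" and p: "p \<in> im i" using q by auto
  let ?x = "\<psi> i p"
  note c = charts_at_\<psi>[OF i p]
  have "(\<lambda>j. snd (tvec P i (u, ?x) a j)) = tvec A i ?x (snd a)"
    unfolding tvec_product[OF c] tvec_eq by auto
  moreover have "fst (tvec P i (u, ?x) a (chart_at A ?x)) = fst a"
    using chart_at_in[of ?x] by (simp add: tvec_product[OF c])
  ultimately show "loc1 P (randers_beta A h \<omega> \<beta>) i q a =
      randers_fn (warped_metric (loc2 A h i) (\<beta> \<circ> \<psi> i) q) (pullback_form (loc1 A \<omega> i) q) a"
    by (simp add: loc1_def loc2_def chart_inv_product[OF i p] randers_beta_def randers_fn_def
        warped_metric_def pullback_form_def power2_eq_square Let_def)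
qed

text \<open>The tangent vector \<open>(v, y)\<close> of the product at a point \<open>(u, x)\<close>, for a number \<open>v\<close> and a tangent
  vector \<open>y\<close> at \<open>x\<close>. It does not depend on \<open>u\<close>.\<close>
definition product_vec :: "'a \<Rightarrow> real \<Rightarrow> ('i \<Rightarrow> 'n) \<Rightarrow> 'i \<Rightarrow> real \<times> 'n" where
  "product_vec x v y = (\<lambda>j. if j \<in> charts_at A x then (v, y j) else 0)"

text \<open>Curves in the product project to curves in \<open>N\<close>; conversely a curve in \<open>N\<close> is lifted by moving
  along the line at constant speed \<open>v\<close>.\<close>
lemma tangent_to_product:
  "w \<in> tangent_to P (UNIV \<times> N) (u, x) \<longleftrightarrow> (\<exists>v. \<exists>y\<in>tangent_to A N x. w = product_vec x v y)"
proof
  assume w: "w \<in> tangent_to P (UNIV \<times> N) (u, x)"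
  define i where "i = chart_at A x"
  have i: "i \<in> charts_at A x" unfolding i_def by (rule chart_at_in)
  define v y where "v = fst (w i)" and "y = (\<lambda>j. snd (w j))"
  obtain \<gamma> :: "real \<Rightarrow> real \<times> 'a" where ws: "w \<in> tangent_space P (u, x)"
    and \<gamma>: "\<gamma> 0 = (u, x)" "isCont \<gamma> 0" "range \<gamma> \<subseteq> UNIV \<times> N"
    and d: "\<And>j. j \<in> charts_at A x \<Longrightarrow> ((chart_map P j \<circ> \<gamma>) has_vector_derivative w j) (at 0)"
    using w unfolding tangent_to_def charts_at_product by blast
  have w0: "w j = 0" if "j \<notin> charts_at A x" for j
    using ws that unfolding tangent_space_def by simp
  have wj: "w k = (fst (w j), jac j k x (snd (w j)))" if "j \<in> charts_at A x" "k \<in> charts_at A x" for j k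
  proof -
    have "w k = dir_deriv (chart_map P k \<circ> chart_inv P j) (chart_map P j (u, x)) (w j)"
      using ws that unfolding tangent_space_def charts_at_product by blast
    then show ?thesis using jac_product[OF that] by (rule trans)
  qed
  have "y \<in> tangent_space A x"
  proof (rule tangentI)
    show "y j = 0" if "j \<notin> charts_at A x" for j using w0[OF that] by (simp add: y_def)
    show "y k = jac j k x (y j)" if "j \<in> charts_at A x" "k \<in> charts_at A x" for j k
      using arg_cong[OF wj[OF that], of snd] by (simp add: y_def)
  qed
  moreover have "((\<kappa> j \<circ> (snd \<circ> \<gamma>)) has_vector_derivative y j) (at 0)" if "j \<in> charts_at A x" for j
  proof -
    have "((\<lambda>t. snd ((chart_map P j \<circ> \<gamma>) t)) has_vector_derivative snd (w j)) (at 0)"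
      using d[OF that] unfolding has_vector_derivative_def by (auto dest: has_derivative_snd)
    moreover have "(\<lambda>t. snd ((chart_map P j \<circ> \<gamma>) t)) = \<kappa> j \<circ> (snd \<circ> \<gamma>)"
      by (rule ext) (simp add: product_atlas_def split: prod.split)
    ultimately show ?thesis by (simp add: y_def)
  qed
  moreover have "isCont (snd \<circ> \<gamma>) 0" "range (snd \<circ> \<gamma>) \<subseteq> N" "(snd \<circ> \<gamma>) 0 = x"
    using \<gamma> by (auto simp: o_def intro: isCont_snd)
  ultimately have "y \<in> tangent_to A N x"
    unfolding tangent_to_def mem_Collect_eq by (intro conjI exI[of _ "snd \<circ> \<gamma>"] ballI)
  moreover have "w = product_vec x v y"
  proof
    fix j show "w j = product_vec x v y j"
    proof (cases "j \<in> charts_at A x")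
      case True
      then have "fst (w j) = v" using arg_cong[OF wj[OF i True], of fst] by (simp add: v_def)
      then show ?thesis using True by (simp add: product_vec_def y_def prod_eq_iff)
    qed (simp add: product_vec_def w0)
  qed
  ultimately show "\<exists>v. \<exists>y\<in>tangent_to A N x. w = product_vec x v y" by blast
next
  assume "\<exists>v. \<exists>y\<in>tangent_to A N x. w = product_vec x v y"
  then obtain v y where y: "y \<in> tangent_to A N x" and w: "w = product_vec x v y" by blast
  obtain \<gamma> :: "real \<Rightarrow> 'a" where ys: "y \<in> tangent_space A x" and \<gamma>: "\<gamma> 0 = x" "isCont \<gamma> 0" "range \<gamma> \<subseteq> N"
    and d: "\<And>i. i \<in> charts_at A x \<Longrightarrow> ((\<kappa> i \<circ> \<gamma>) has_vector_derivative y i) (at 0)"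
    using y unfolding tangent_to_def by blast
  let ?\<gamma> = "\<lambda>t. (u + t * v, \<gamma> t)"
  have "w k = dir_deriv (chart_map P k \<circ> chart_inv P j) (chart_map P j (u, x)) (w j)"
    if "j \<in> charts_at A x" "k \<in> charts_at A x" for j k
    using jac_product[OF that] that tangentD(2)[OF ys] by (simp add: w product_vec_def)
  moreover have "w j = 0" if "j \<notin> charts_at A x" for j
    using that by (simp add: w product_vec_def)
  ultimately have "w \<in> tangent_space P (u, x)"
    unfolding tangent_space_def charts_at_product by blast
  moreover have "((chart_map P j \<circ> ?\<gamma>) has_vector_derivative w j) (at 0)" if "j \<in> charts_at A x" for j
  proof -
    have "((\<lambda>t. (u + t * v, (\<kappa> j \<circ> \<gamma>) t)) has_vector_derivative (v, y j)) (at 0)"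
      by (intro has_vector_derivative_Pair d that)
        (auto simp: has_vector_derivative_def intro!: derivative_eq_intros)
    moreover have "(\<lambda>t. (u + t * v, (\<kappa> j \<circ> \<gamma>) t)) = chart_map P j \<circ> ?\<gamma>" by (rule ext) simp
    ultimately show ?thesis using that by (simp add: w product_vec_def)
  qed
  moreover have "isCont ?\<gamma> 0" by (intro continuous_intros \<gamma>(2))
  moreover have "range ?\<gamma> \<subseteq> UNIV \<times> N" "?\<gamma> 0 = (u, x)" using \<gamma> by auto
  ultimately show "w \<in> tangent_to P (UNIV \<times> N) (u, x)"
    unfolding tangent_to_def mem_Collect_eq charts_at_product by (intro conjI exI[of _ ?\<gamma>] ballI)
qed

end

section \<open>An elementary optimization\<close>

text \<open>Here \<open>s\<close> stands for the length of \<open>(v, y)\<close> and \<open>hy\<close> for the squared length of \<open>y\<close>. The left-hand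
  side bounds a concave quadratic polynomial in \<open>s\<close> on the half line from \<open>sqrt hy\<close>. For \<open>b > 0\<close>
  the vertex is \<open>W / b\<close>. If it lies left of the half line, the maximum is at the end point and the
  assumption on \<open>H\<close> gives both sides. Otherwise the value at the vertex is the second alternative,
  which the first alternative implies. For \<open>b = 0\<close> both sides say that \<open>W = 0\<close>.\<close>
lemma warped_convexity_iff:
  fixes H W hy b :: real
  assumes hy: "hy \<ge> 0" and b: "b \<ge> 0" and W: "W \<ge> 0" and H: "H + sqrt hy * W \<le> 0"
  shows "(\<forall>s\<ge>sqrt hy. 2 * (H + s * W) - b * (s\<^sup>2 - hy) \<le> 0) \<longleftrightarrow>
    W\<^sup>2 + b * H \<le> 0 \<or> b > 0 \<and> 2 * H + W\<^sup>2 / b + b * hy \<le> 0" (is "?L \<longleftrightarrow> ?R")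
proof (cases "b = 0")
  case True
  have "W = 0" if ?L
  proof (rule ccontr)
    assume "W \<noteq> 0"
    \<comment> \<open>At \<open>(1 - H) / W\<close> the linear function \<open>H + s W\<close> takes the value 1.\<close>
    let ?s = "max (sqrt hy) ((1 - H) / W)"
    have "H + ?s * W \<le> 0" using that[rule_format, of ?s] True by simp
    moreover have "(1 - H) / W * W \<le> ?s * W" using W by (intro mult_right_mono) auto
    ultimately show False using \<open>W \<noteq> 0\<close> by simp
  qed
  moreover have ?L if "W = 0" using that H True by simp
  ultimately show ?thesis using True by auto
next
  case False
  then have b: "b > 0" using b by simp
  define r where "r = sqrt hy"
  have r: "r \<ge> 0" "r\<^sup>2 = hy" using hy by (simp_all add: r_def)
  have sq: "2 * (H + s * W) - b * (s\<^sup>2 - hy) = 2 * H + W\<^sup>2 / b + b * hy - (b * s - W)\<^sup>2 / b" for s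
    using b by (simp add: field_simps power2_eq_square)
  show ?thesis
  proof (cases "W \<le> b * r")
    case True
    have "b * H + b * r * W \<le> 0" using mult_nonneg_nonpos[OF _ H, of b] b
      by (simp add: r_def algebra_simps)
    moreover have "W * W \<le> b * r * W" using True W by (rule mult_right_mono)
    ultimately have ?R by (simp add: power2_eq_square)
    moreover have "2 * (H + s * W) - b * (s\<^sup>2 - hy) \<le> 0" if "s \<ge> sqrt hy" for s
    proof -
      have s: "s \<ge> r" using that by (simp add: r_def)
      have "b * r \<le> b * s" using s b by simp
      then have "2 * W \<le> b * (s + r)" using True by (simp add: distrib_left)
      then have "(s - r) * (2 * W - b * (s + r)) \<le> 0" using s by (intro mult_nonneg_nonpos) auto
      then have "2 * (H + s * W) - b * (s\<^sup>2 - r\<^sup>2) \<le> 2 * (H + r * W)"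
        by (simp add: algebra_simps power2_eq_square)
      then show ?thesis using H r by (simp add: r_def)
    qed
    ultimately show ?thesis by blast
  next
    case False
    have "?L \<longleftrightarrow> 2 * H + W\<^sup>2 / b + b * hy \<le> 0"
    proof
      assume ?L
      moreover have "sqrt hy \<le> W / b" using False b by (simp add: r_def field_simps)
      ultimately have "2 * H + W\<^sup>2 / b + b * hy - (b * (W / b) - W)\<^sup>2 / b \<le> 0"
        unfolding sq[symmetric] by blast
      then show "2 * H + W\<^sup>2 / b + b * hy \<le> 0" using b by simp
    next
      assume *: "2 * H + W\<^sup>2 / b + b * hy \<le> 0"
      show ?L
      proof (intro allI impI)
        fix s have "(b * s - W)\<^sup>2 / b \<ge> 0" using b by simp
        then show "2 * (H + s * W) - b * (s\<^sup>2 - hy) \<le> 0" using * unfolding sq by linarith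
      qed
    qed
    moreover have "2 * H + W\<^sup>2 / b + b * hy \<le> 0" if "W\<^sup>2 + b * H \<le> 0"
    proof -
      have "(b * r)\<^sup>2 \<le> W\<^sup>2" using False b r by (intro power_mono) auto
      then have "b * (b * hy) \<le> W\<^sup>2" using r by (simp add: power2_eq_square algebra_simps)
      then have "b * (2 * H + W\<^sup>2 / b + b * hy) \<le> 0" using that b by (simp add: distrib_left)
      then show ?thesis using b by (simp add: mult_le_0_iff)
    qed
    ultimately show ?thesis using b by blast
  qed
qed

section \<open>Convexity at a boundary point\<close>
lemma C_manifold_2D:
  assumes "C_manifold 2 A f" "i \<in> chart_index A" "p \<in> chart_map A i ` chart_dom A i"
  shows "(f \<circ> chart_inv A i) differentiable (at p)"
    and "(\<lambda>p. dir_deriv (f \<circ> chart_inv A i) p a) differentiable (at p)"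
proof -
  have "C_on (Suc (Suc 0)) (f \<circ> chart_inv A i) (chart_map A i ` chart_dom A i)"
    using assms(1,2) unfolding C_manifold_def numeral_2_eq_2 by blast
  then show "(f \<circ> chart_inv A i) differentiable (at p)"
    and "(\<lambda>p. dir_deriv (f \<circ> chart_inv A i) p a) differentiable (at p)"
    using assms(3) by (simp_all only: C_on.simps)
qed

text \<open>A point \<open>x\<close> of a set \<open>N\<close> on which a \<open>C\<^sup>2\<close> function \<open>\<phi>\<close> vanishes. All tensors at \<open>x\<close> are computed
  in the chart \<open>i\<close> that the coordinate definitions use.\<close>
locale boundary_point = manifold A
  for A :: "('i, 'a::{t2_space,second_countable_topology}, 'n::euclidean_space) atlas" +
  fixes h :: "'a \<Rightarrow> ('i \<Rightarrow> 'n) \<Rightarrow> ('i \<Rightarrow> 'n) \<Rightarrow> real" and \<omega> :: "'a \<Rightarrow> ('i \<Rightarrow> 'n) \<Rightarrow> real"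
    and \<beta> \<phi> :: "'a \<Rightarrow> real" and N :: "'a set" and x :: 'a
  assumes randers: "randers_space A h \<omega>"
    and \<beta>_smooth: "Cinf_manifold A \<beta>" and \<beta>_gt_0: "\<beta> z > 0"
    and \<phi>_C2: "C_manifold 2 A \<phi>" and \<phi>_zero: "z \<in> N \<Longrightarrow> \<phi> z = 0"
    and x_N: "x \<in> N"
begin

abbreviation "i \<equiv> chart_at A x"
abbreviation "p \<equiv> \<kappa> i x"
abbreviation "T \<equiv> tangent_to A N x"
abbreviation "H \<equiv> riemann_hessian A h \<phi> x"
abbreviation "grad f \<equiv> gradient A h f x"
abbreviation "d\<omega> \<equiv> ext_deriv A \<omega> x"

lemma i: "i \<in> charts_at A x" "i \<in> chart_index A" "p \<in> im i"
  using chart_at_in charts_atD by auto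

lemma T_tangent: "y \<in> T \<Longrightarrow> y \<in> tangent_space A x"
  unfolding tangent_to_def by blast

sublocale randers_product "im i" "loc2 A h i" "loc1 A \<omega> i" "\<beta> \<circ> \<psi> i"
proof (intro randers_product.intro randers_product_axioms.intro randers_field_loc randers i)
  fix q assume q: "q \<in> im i"
  show "0 < (\<beta> \<circ> \<psi> i) q" using \<beta>_gt_0 by simp
  have "C_manifold 2 A \<beta>" using \<beta>_smooth by (simp add: Cinf_manifold_def)
  then show "(\<beta> \<circ> \<psi> i) differentiable (at q)" by (rule C_manifold_2D[OF _ i(2) q])
qed

lemmas \<phi>_diff = C_manifold_2D[OF \<phi>_C2 i(2)]

lemma \<phi>_tangent: "y \<in> T \<Longrightarrow> dir_deriv (\<phi> \<circ> \<psi> i) p (y i) = 0"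
  by (rule tangent_to_kernel[OF _ \<phi>_zero i(1) \<phi>_diff(1)[OF i(3)]])

lemma metric: "riemannian_metric A h"
  using randers by (simp add: randers_space_def)

lemma H_coord: "H y y = hessian_coord (christoffel (loc2 A h i) p) (\<phi> \<circ> \<psi> i) p (y i) (y i)"
  by (simp add: riemann_hessian_def Let_def)

lemma d\<omega>_coord: "d\<omega> y z = ext_deriv_coord (loc1 A \<omega> i) p (y i) (z i)"
  by (simp add: ext_deriv_def ext_deriv_coord_def Let_def)

lemma grad_\<phi>: "grad \<phi> \<in> tangent_space A x" "grad \<phi> i = riesz (loc2 A h i p) (dir_deriv (\<phi> \<circ> \<psi> i) p)"
  using gradient_eq[OF metric \<phi>_diff(1)[OF i(3)]] by simp_all

lemma grad_\<beta>: "grad \<beta> \<in> tangent_space A x" "grad \<beta> i = riesz (loc2 A h i p) (dir_deriv (\<beta> \<circ> \<psi> i) p)"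
  using gradient_eq[OF metric diff_\<beta>[OF i(3)]] by simp_all

lemma \<beta>_coord: "(\<beta> \<circ> \<psi> i) p = \<beta> x"
  by (simp add: \<psi>_\<kappa> charts_atD[OF i(1)])

lemma h_nonneg: "y \<in> T \<Longrightarrow> h x y y \<ge> 0"
  using scalar_product.nonneg[OF scalar_product[OF i(3)], of "y i"] loc2_at[OF i(1) T_tangent T_tangent, of y y h]
  by simp

text \<open>The cases needed are \<open>c = 0\<close> and \<open>c = -1\<close>: the zero vector, and the reversal of \<open>y\<close>, which turns
  a bound on \<open>\<plusminus>d\<omega>(y, grad \<phi>)\<close> into one on the absolute value.\<close>
lemma scale:
  fixes c :: real
  assumes y: "y \<in> T"
  defines "y' \<equiv> (\<lambda>j. c *\<^sub>R y j)"
  shows "y' \<in> T" "H y' y' = c\<^sup>2 * H y y" "d\<omega> y' z = c * d\<omega> y z" "h x y' y' = c\<^sup>2 * h x y y"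
proof -
  show y': "y' \<in> T" unfolding y'_def by (rule tangent_to_scale[OF y])
  show "H y' y' = c\<^sup>2 * H y y"
    unfolding H_coord y'_def by (rule hessian_scale[OF i(3) \<phi>_diff(1) \<phi>_diff(2)[OF i(3)]])
  show "d\<omega> y' z = c * d\<omega> y z"
    unfolding d\<omega>_coord y'_def by (rule ext_deriv_coord_scale[OF i(3)])
  interpret S: scalar_product "loc2 A h i p" by (rule scalar_product[OF i(3)])
  show "h x y' y' = c\<^sup>2 * h x y y"
    using loc2_at[OF i(1), of y y h] loc2_at[OF i(1), of y' y' h] T_tangent[OF y] T_tangent[OF y']
    by (simp add: y'_def power2_eq_square)
qed

lemma chern_hessian_randers:
  assumes y: "y \<in> T" "y \<noteq> (\<lambda>_. 0)"
  shows "chern_hessian A (randers_metric h \<omega>) \<phi> x y y y = H y y - sqrt (h x y y) * d\<omega> y (grad \<phi>)"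
proof -
  have "y i \<noteq> 0" using tangent_nonzero[OF i(1) T_tangent] y by blast
  then have "hessian_coord (chern_coeff (loc1 A (randers_metric h \<omega>) i) (y i) p) (\<phi> \<circ> \<psi> i) p (y i) (y i)
      = hessian_coord (christoffel (loc2 A h i) p) (\<phi> \<circ> \<psi> i) p (y i) (y i)
        - sqrt (loc2 A h i p (y i) (y i)) * ext_deriv_coord (loc1 A \<omega> i) p (y i)
            (riesz (loc2 A h i p) (dir_deriv (\<phi> \<circ> \<psi> i) p))"
    by (intro hessian_chern_randers loc1_randers i \<phi>_diff \<phi>_tangent y)
  then show ?thesis
    by (simp add: chern_hessian_def Let_def H_coord d\<omega>_coord grad_\<phi> loc2_at[OF i(1)] T_tangent[OF y(1)])
qed

lemma product_vec_eq_0: "y \<in> T \<Longrightarrow> product_vec x v y = (\<lambda>_. 0) \<longleftrightarrow> v = 0 \<and> y = (\<lambda>_. 0)"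
  using tangent_nonzero[OF i(1) T_tangent, of y] i(1)
  by (auto simp: product_vec_def fun_eq_iff prod_eq_iff split: if_splits)

lemma chern_hessian_randers_beta:
  assumes y: "y \<in> T" and nz: "v \<noteq> 0 \<or> y \<noteq> (\<lambda>_. 0)"
  defines "w \<equiv> product_vec x v y"
  shows "chern_hessian P (randers_beta A h \<omega> \<beta>) (\<lambda>(u, x). \<phi> x) (u, x) w w w =
    H y y - v\<^sup>2 / (2 * (\<beta> x)\<^sup>2) * h x (grad \<phi>) (grad \<beta>)
    - sqrt (h x y y + v\<^sup>2 / \<beta> x) * d\<omega> y (grad \<phi>)"
proof -
  let ?f = "(\<lambda>(u, x). \<phi> x) \<circ> chart_inv P i"
  let ?\<Gamma> = "chern_coeff (loc1 P (randers_beta A h \<omega> \<beta>) i) (v, y i) (u, p)"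
  have w: "w i = (v, y i)" using i(1) by (simp add: w_def product_vec_def)
  have nz': "(v, y i) \<noteq> 0" using nz tangent_nonzero[OF i(1) T_tangent[OF y]] by (auto simp: prod_eq_iff)
  have "hessian_coord ?\<Gamma> ?f (u, p) (v, y i) (v, y i)
      = hessian_coord ?\<Gamma> (\<lambda>q. (\<phi> \<circ> \<psi> i) (snd q)) (u, p) (v, y i) (v, y i)"
    by (rule hessian_coord_cong[OF product.open_U]) (use i in \<open>auto simp: chart_inv_product\<close>)
  also have "\<dots> = hessian_coord (christoffel (loc2 A h i) p) (\<phi> \<circ> \<psi> i) p (y i) (y i)
    - v\<^sup>2 / (2 * ((\<beta> \<circ> \<psi> i) p)\<^sup>2) * loc2 A h i p (riesz (loc2 A h i p) (dir_deriv (\<phi> \<circ> \<psi> i) p))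
        (riesz (loc2 A h i p) (dir_deriv (\<beta> \<circ> \<psi> i) p))
    - sqrt (loc2 A h i p (y i) (y i) + v\<^sup>2 / (\<beta> \<circ> \<psi> i) p) *
      ext_deriv_coord (loc1 A \<omega> i) p (y i) (riesz (loc2 A h i p) (dir_deriv (\<phi> \<circ> \<psi> i) p))"
    by (rule hessian_chern_product[OF loc1_randers_beta[OF i(2)] i(3) nz' \<phi>_diff(1) \<phi>_diff(2)[OF i(3)]
        \<phi>_tangent[OF y]])
  finally show ?thesis
    unfolding \<beta>_coord grad_\<phi>(2)[symmetric] grad_\<beta>(2)[symmetric] d\<omega>_coord[symmetric] H_coord[symmetric]
      loc2_at[OF i(1) T_tangent[OF y] T_tangent[OF y]] loc2_at[OF i(1) grad_\<phi>(1) grad_\<beta>(1)]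
    by (simp add: chern_hessian_def Let_def w)
qed

lemma convex_iff:
  "infinitesimally_convex_at A (randers_metric h \<omega>) N \<phi> x \<longleftrightarrow>
    (\<forall>y\<in>T. H y y + sqrt (h x y y) * \<bar>d\<omega> y (grad \<phi>)\<bar> \<le> 0)" (is "?L \<longleftrightarrow> ?R")
proof
  assume L: ?L
  have *: "H y y - sqrt (h x y y) * d\<omega> y (grad \<phi>) \<le> 0" if y: "y \<in> T" for y
  proof (cases "y = (\<lambda>_. 0)")
    case True
    then show ?thesis
      using scale(2-4)[OF y, of 0] by simp
  next
    case False
    then show ?thesis
      using L y unfolding infinitesimally_convex_at_def chern_hessian_randers[OF y False, symmetric] by blast
  qed
  show ?R
  proof
    fix y assume y: "y \<in> T"
    show "H y y + sqrt (h x y y) * \<bar>d\<omega> y (grad \<phi>)\<bar> \<le> 0"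
      using *[OF y] *[OF scale(1)[OF y, of "- 1"]] scale(2-4)[OF y, of "- 1"]
      by (cases "d\<omega> y (grad \<phi>) \<ge> 0") simp_all
  qed
next
  assume R: ?R
  show ?L
    unfolding infinitesimally_convex_at_def
  proof
    fix y assume y: "y \<in> T - {\<lambda>_. 0}"
    have "sqrt (h x y y) * - d\<omega> y (grad \<phi>) \<le> sqrt (h x y y) * \<bar>d\<omega> y (grad \<phi>)\<bar>"
      using h_nonneg y by (intro mult_left_mono) auto
    then show "chern_hessian A (randers_metric h \<omega>) \<phi> x y y y \<le> 0"
      using R y chern_hessian_randers[of y] by force
  qed
qed

text \<open>The zero vector is excluded on the left-hand side but harmless on the right-hand side, where all
  terms vanish.\<close>
lemma product_convex_iff:
  "infinitesimally_convex_at P (randers_beta A h \<omega> \<beta>) (UNIV \<times> N) (\<lambda>(u, x). \<phi> x) (u, x) \<longleftrightarrow>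
    (\<forall>y\<in>T. \<forall>v. H y y - v\<^sup>2 / (2 * (\<beta> x)\<^sup>2) * h x (grad \<phi>) (grad \<beta>)
      + sqrt (h x y y + v\<^sup>2 / \<beta> x) * \<bar>d\<omega> y (grad \<phi>)\<bar> \<le> 0)" (is "?L \<longleftrightarrow> ?R")
proof
  assume L: ?L
  let ?K = "\<lambda>v y. H y y - v\<^sup>2 / (2 * (\<beta> x)\<^sup>2) * h x (grad \<phi>) (grad \<beta>)
    - sqrt (h x y y + v\<^sup>2 / \<beta> x) * d\<omega> y (grad \<phi>)"
  have *: "?K v y \<le> 0" if y: "y \<in> T" for v y
  proof (cases "v = 0 \<and> y = (\<lambda>_. 0)")
    case True
    then show ?thesis using scale(2-4)[OF y, of 0] by simp
  next
    case False
    then have nz: "v \<noteq> 0 \<or> y \<noteq> (\<lambda>_. 0)" by blast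
    have "product_vec x v y \<in> tangent_to P (UNIV \<times> N) (u, x) - {\<lambda>_. 0}"
      using y False product_vec_eq_0[OF y] tangent_to_product by blast
    then show ?thesis
      using L chern_hessian_randers_beta[OF y nz, where u = u]
      unfolding infinitesimally_convex_at_def by metis
  qed
  show ?R
  proof (intro ballI allI)
    fix v y assume y: "y \<in> T"
    show "H y y - v\<^sup>2 / (2 * (\<beta> x)\<^sup>2) * h x (grad \<phi>) (grad \<beta>)
        + sqrt (h x y y + v\<^sup>2 / \<beta> x) * \<bar>d\<omega> y (grad \<phi>)\<bar> \<le> 0"
      using *[OF y, of v] *[OF scale(1)[OF y, of "- 1"], of v] scale(2-4)[OF y, of "- 1"]
      by (cases "d\<omega> y (grad \<phi>) \<ge> 0") simp_all
  qed
next
  assume R: ?R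
  show ?L
    unfolding infinitesimally_convex_at_def
  proof
    fix w assume w: "w \<in> tangent_to P (UNIV \<times> N) (u, x) - {\<lambda>_. 0}"
    then obtain v y where y: "y \<in> T" and wv: "w = product_vec x v y"
      using tangent_to_product by blast
    have nz: "v \<noteq> 0 \<or> y \<noteq> (\<lambda>_. 0)" using w wv product_vec_eq_0[OF y] by blast
    have "h x y y + v\<^sup>2 / \<beta> x \<ge> 0" using h_nonneg[OF y] \<beta>_gt_0[of x] by simp
    then have "sqrt (h x y y + v\<^sup>2 / \<beta> x) * - d\<omega> y (grad \<phi>)
        \<le> sqrt (h x y y + v\<^sup>2 / \<beta> x) * \<bar>d\<omega> y (grad \<phi>)\<bar>"
      by (intro mult_left_mono) auto
    then have "H y y - v\<^sup>2 / (2 * (\<beta> x)\<^sup>2) * h x (grad \<phi>) (grad \<beta>)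
        - sqrt (h x y y + v\<^sup>2 / \<beta> x) * d\<omega> y (grad \<phi>) \<le> 0"
      using R[rule_format, OF y, of v] unfolding mult_minus_right by linarith
    then show "chern_hessian P (randers_beta A h \<omega> \<beta>) (\<lambda>(u, x). \<phi> x) (u, x) w w w \<le> 0"
      unfolding wv chern_hessian_randers_beta[OF y nz] .
  qed
qed

text \<open>For fixed \<open>y\<close> the quantity to be bounded depends on \<open>v\<close> only through the length
  \<open>s = sqrt (h(y, y) + v\<^sup>2 / \<beta>)\<close>, which runs through the half line from \<open>sqrt (h(y, y))\<close>. Condition i)
  is the case \<open>v = 0\<close>, and condition ii) is the direction of the line itself, \<open>y = 0\<close>, \<open>v = 1\<close>.\<close>
lemma product_convex_conditions:
  "infinitesimally_convex_at P (randers_beta A h \<omega> \<beta>) (UNIV \<times> N) (\<lambda>(u, x). \<phi> x) (u, x) \<longleftrightarrow>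
    infinitesimally_convex_at A (randers_metric h \<omega>) N \<phi> x \<and>
    0 \<le> h x (grad \<phi>) (grad \<beta>) \<and>
    (\<forall>y\<in>T. (d\<omega> y (grad \<phi>))\<^sup>2 + h x (grad \<phi>) (grad \<beta>) / \<beta> x * H y y \<le> 0 \<or>
       (h x (grad \<phi>) (grad \<beta>) > 0 \<and>
        2 * H y y + \<beta> x / h x (grad \<phi>) (grad \<beta>) * (d\<omega> y (grad \<phi>))\<^sup>2
          + h x (grad \<phi>) (grad \<beta>) / \<beta> x * h x y y \<le> 0))"
  (is "_ \<longleftrightarrow> _ \<and> 0 \<le> ?B \<and> (\<forall>y\<in>T. ?C y)")
proof -
  define b where "b = ?B / \<beta> x"
  have \<beta>: "\<beta> x > 0" by (rule \<beta>_gt_0)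
  let ?K = "\<lambda>v y. H y y - v\<^sup>2 / (2 * (\<beta> x)\<^sup>2) * ?B + sqrt (h x y y + v\<^sup>2 / \<beta> x) * \<bar>d\<omega> y (grad \<phi>)\<bar>"
  let ?E = "\<lambda>y. \<forall>s\<ge>sqrt (h x y y). 2 * (H y y + s * \<bar>d\<omega> y (grad \<phi>)\<bar>) - b * (s\<^sup>2 - h x y y) \<le> 0"
  have K: "2 * ?K v y = 2 * (H y y + sqrt (h x y y + v\<^sup>2 / \<beta> x) * \<bar>d\<omega> y (grad \<phi>)\<bar>)
      - b * ((sqrt (h x y y + v\<^sup>2 / \<beta> x))\<^sup>2 - h x y y)" if "y \<in> T" for v y
    using h_nonneg[OF that] \<beta> by (simp add: b_def power2_eq_square field_simps)
  have E: "(\<forall>v. ?K v y \<le> 0) \<longleftrightarrow> ?E y" if y: "y \<in> T" for y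
  proof
    assume L: "\<forall>v. ?K v y \<le> 0"
    show "?E y"
    proof (intro allI impI)
      fix s assume s: "sqrt (h x y y) \<le> s"
      then have s0: "s \<ge> 0" using h_nonneg[OF y] real_sqrt_ge_zero order_trans by blast
      have "h x y y \<le> s\<^sup>2" using s sqrt_le_D by blast
      \<comment> \<open>Solve \<open>s = sqrt (h(y, y) + v\<^sup>2 / \<beta>)\<close> for \<open>v\<close>.\<close>
      then have "sqrt (h x y y + (sqrt (\<beta> x * (s\<^sup>2 - h x y y)))\<^sup>2 / \<beta> x) = s"
        using \<beta> s0 by simp
      then show "2 * (H y y + s * \<bar>d\<omega> y (grad \<phi>)\<bar>) - b * (s\<^sup>2 - h x y y) \<le> 0"
        using K[OF y, of "sqrt (\<beta> x * (s\<^sup>2 - h x y y))"] L[rule_format, of "sqrt (\<beta> x * (s\<^sup>2 - h x y y))"]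
        by simp
    qed
  next
    assume R: "?E y"
    show "\<forall>v. ?K v y \<le> 0"
    proof
      fix v
      have "sqrt (h x y y) \<le> sqrt (h x y y + v\<^sup>2 / \<beta> x)" using \<beta> by simp
      with R have "2 * ?K v y \<le> 0" unfolding K[OF y] by blast
      then show "?K v y \<le> 0" by simp
    qed
  qed
  have C: "?E y \<longleftrightarrow> ?C y"
    if y: "y \<in> T" and "H y y + sqrt (h x y y) * \<bar>d\<omega> y (grad \<phi>)\<bar> \<le> 0" and "0 \<le> ?B" for y
  proof -
    have "?E y \<longleftrightarrow> \<bar>d\<omega> y (grad \<phi>)\<bar>\<^sup>2 + b * H y y \<le> 0 \<or>
        b > 0 \<and> 2 * H y y + \<bar>d\<omega> y (grad \<phi>)\<bar>\<^sup>2 / b + b * h x y y \<le> 0"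
      by (rule warped_convexity_iff) (use h_nonneg[OF y] that \<beta> in \<open>simp_all add: b_def\<close>)
    moreover have "b > 0 \<longleftrightarrow> ?B > 0" using \<beta> by (simp add: b_def zero_less_divide_iff)
    ultimately show ?thesis by (simp add: b_def mult.commute)
  qed
  have cond_i: "H y y + sqrt (h x y y) * \<bar>d\<omega> y (grad \<phi>)\<bar> \<le> 0" if "?K 0 y \<le> 0" for y
    using that by simp
  have cond_ii: "0 \<le> ?B" if "\<forall>y\<in>T. \<forall>v. ?K v y \<le> 0"
  proof -
    have 0: "(\<lambda>_. 0) \<in> T" by (rule zero_tangent_to[OF x_N])
    have "?K 1 (\<lambda>_. 0) \<le> 0" using that 0 by blast
    then have "0 \<le> ?B / (2 * (\<beta> x)\<^sup>2)" using scale(2-4)[OF 0, of 0] by simp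
    then show ?thesis using \<beta> by (simp add: zero_le_divide_iff)
  qed
  show ?thesis
    unfolding product_convex_iff convex_iff
  proof
    assume L: "\<forall>y\<in>T. \<forall>v. ?K v y \<le> 0"
    then show "(\<forall>y\<in>T. H y y + sqrt (h x y y) * \<bar>d\<omega> y (grad \<phi>)\<bar> \<le> 0) \<and> 0 \<le> ?B \<and> (\<forall>y\<in>T. ?C y)"
      using cond_i cond_ii[OF L] C E by blast
  next
    assume "(\<forall>y\<in>T. H y y + sqrt (h x y y) * \<bar>d\<omega> y (grad \<phi>)\<bar> \<le> 0) \<and> 0 \<le> ?B \<and> (\<forall>y\<in>T. ?C y)"
    then show "\<forall>y\<in>T. \<forall>v. ?K v y \<le> 0" using C E by blast
  qed
qed

end

theorem proposition3p10:
  fixes A :: "('i, 'a::{t2_space,second_countable_topology}, 'n::euclidean_space) atlas"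
    and h :: "'a \<Rightarrow> ('i \<Rightarrow> 'n) \<Rightarrow> ('i \<Rightarrow> 'n) \<Rightarrow> real"
    and \<omega> :: "'a \<Rightarrow> ('i \<Rightarrow> 'n) \<Rightarrow> real"
    and \<beta> \<phi> :: "'a \<Rightarrow> real"
    and D :: "'a set"
  assumes "randers_space A h \<omega>"
    and "Cinf_manifold A \<beta>" and "\<forall>x. \<beta> x > 0"
    and "C2_domain A D"
    and "C2_defining_function A D \<phi>"
  defines "R \<equiv> randers_metric h \<omega>"
    and "R\<^sub>\<beta> \<equiv> randers_beta A h \<omega> \<beta>"
    and "T \<equiv> tangent_to A (frontier D)"
    and "grad \<equiv> gradient A h"
    and "H \<equiv> riemann_hessian A h \<phi>"
    and "d\<omega> \<equiv> ext_deriv A \<omega>"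
  shows "(\<forall>x\<in>frontier D. infinitesimally_convex_at A R (frontier D) \<phi> x \<longleftrightarrow>
           (\<forall>y\<in>T x. H x y y + sqrt (h x y y) * \<bar>d\<omega> x y (grad \<phi> x)\<bar> \<le> 0)) \<and>
         (infinitesimally_convex (product_atlas A) R\<^sub>\<beta> (UNIV \<times> frontier D) (\<lambda>(u, x). \<phi> x) \<longleftrightarrow>
         (\<forall>x\<in>frontier D.
            infinitesimally_convex_at A R (frontier D) \<phi> x \<and>
            0 \<le> h x (grad \<phi> x) (grad \<beta> x) \<and>
            (\<forall>y\<in>T x.
               (d\<omega> x y (grad \<phi> x))\<^sup>2 + h x (grad \<phi> x) (grad \<beta> x) / \<beta> x * H x y y \<le> 0 \<or>
               (h x (grad \<phi> x) (grad \<beta> x) > 0 \<and>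
                2 * H x y y + \<beta> x / h x (grad \<phi> x) (grad \<beta> x) * (d\<omega> x y (grad \<phi> x))\<^sup>2
                  + h x (grad \<phi> x) (grad \<beta> x) / \<beta> x * h x y y \<le> 0))))"
proof -
  have point: "boundary_point A h \<omega> \<beta> \<phi> (frontier D) x" if "x \<in> frontier D" for x
    using assms(1-3,5) that
    unfolding boundary_point_def boundary_point_axioms_def manifold_def randers_space_def
      C2_defining_function_def by blast
  have "infinitesimally_convex (product_atlas A) R\<^sub>\<beta> (UNIV \<times> frontier D) (\<lambda>(u, x). \<phi> x) \<longleftrightarrow>
      (\<forall>x\<in>frontier D. \<forall>u. infinitesimally_convex_at (product_atlas A) R\<^sub>\<beta> (UNIV \<times> frontier D) (\<lambda>(u, x). \<phi> x) (u, x))"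
    unfolding infinitesimally_convex_def by blast
  then show ?thesis
    using boundary_point.convex_iff[OF point] boundary_point.product_convex_conditions[OF point]
    unfolding R_def R\<^sub>\<beta>_def T_def grad_def H_def d\<omega>_def by simp
qed

end
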